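(* Let $\kappa,\rho>0$, $p\in\mathbb{N}$ and $\gamma>4d(\kappa p+\rho)$. Then $\lambda_p=\sup\sigma(\mathcal{H}^p)$ is positive, isolated in the spectrum of $\mathcal{H}^p$, and belongs to the point spectrum of $\mathcal{H}^p$ with one-dimensional eigenspace. The corresponding eigenfunction may be chosen strictly positive.
   Context: $\mathcal{H}^p:=\mathcal{A}^p+\gamma V^p$ is the bounded self-adjoint operator on $l^2(\mathbb{Z}^{pd})$, $d\ge1$, where for $x=(x_1,\dots,x_p)$ with $x_i\in\mathbb{Z}^d$: $(V^pf)(x)=\sum_{i=1}^p\delta_0(x_i)f(x)$ and $$\mathcal{A}^pf(x)=\kappa\sum_{e\in\mathbb{Z}^{pd},\,|e|=1}\big(f(x+e)-f(x)\big)+\rho\sum_{e\in\mathbb{Z}^d,\,|e|=1}\big(f(x_1+e,\dots,x_p+e)-f(x)\big).$$ $\sigma(\cdot)$ denotes the spectrum; the point spectrum is the set of eigenvalues. *)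

theory Defs
  imports "HOL-Analysis.Analysis"
begin

section \<open>Square-summable functions and bounded operators\<close>

text \<open>Operators are represented by total maps on all functions; only their action on
  \<open>l2\<close> matters.\<close>

definition l2 :: "('a \<Rightarrow> complex) set" where
  "l2 = {f. (\<lambda>x. (cmod (f x))\<^sup>2) summable_on UNIV}"

definition l2_norm :: "('a \<Rightarrow> complex) \<Rightarrow> real" where
  "l2_norm f = sqrt (\<Sum>\<^sub>\<infinity>x. (cmod (f x))\<^sup>2)"

definition bounded_l2_op :: "(('a \<Rightarrow> complex) \<Rightarrow> ('a \<Rightarrow> complex)) \<Rightarrow> bool" where
  "bounded_l2_op T \<longleftrightarrow>
     (\<forall>f\<in>l2. T f \<in> l2) \<and>
     (\<forall>f\<in>l2. \<forall>g\<in>l2. T (\<lambda>x. f x + g x) = (\<lambda>x. T f x + T g x)) \<and>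
     (\<forall>c. \<forall>f\<in>l2. T (\<lambda>x. c * f x) = (\<lambda>x. c * T f x)) \<and>
     (\<exists>C. \<forall>f\<in>l2. l2_norm (T f) \<le> C * l2_norm f)"

definition l2_resolvent_set :: "(('a \<Rightarrow> complex) \<Rightarrow> ('a \<Rightarrow> complex)) \<Rightarrow> complex set" where
  "l2_resolvent_set T =
     {z. \<exists>R. bounded_l2_op R \<and>
          (\<forall>f\<in>l2. R (\<lambda>x. T f x - z * f x) = f) \<and>
          (\<forall>f\<in>l2. (\<lambda>x. T (R f) x - z * R f x) = f)}"

definition l2_spectrum :: "(('a \<Rightarrow> complex) \<Rightarrow> ('a \<Rightarrow> complex)) \<Rightarrow> complex set" where
  "l2_spectrum T = - l2_resolvent_set T"

definition l2_eigenspace ::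
    "(('a \<Rightarrow> complex) \<Rightarrow> ('a \<Rightarrow> complex)) \<Rightarrow> complex \<Rightarrow> ('a \<Rightarrow> complex) set" where
  "l2_eigenspace T z = {f \<in> l2. T f = (\<lambda>x. z * f x)}"

definition l2_point_spectrum :: "(('a \<Rightarrow> complex) \<Rightarrow> ('a \<Rightarrow> complex)) \<Rightarrow> complex set" where
  "l2_point_spectrum T = {z. \<exists>f \<in> l2_eigenspace T z. f \<noteq> (\<lambda>x. 0)}"

definition one_dimensional :: "('a \<Rightarrow> complex) set \<Rightarrow> bool" where
  "one_dimensional E \<longleftrightarrow> (\<exists>v. v \<noteq> (\<lambda>x. 0) \<and> E = {(\<lambda>x. c * v x) | c. True})"


section \<open>The operator on the lattice\<close>

text \<open>A point of \<open>\<int>\<^sup>p\<^sup>d\<close> is a \<open>p\<close>-tuple \<open>x\<close> of points \<open>x $ i\<close> of \<open>\<int>\<^sup>d\<close>, with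
  \<open>p = CARD('p)\<close> and \<open>d = CARD('d)\<close>, both positive. The unit vectors are those of the
  \<open>1\<close>-norm; for integer vectors the Euclidean norm yields the same ones.\<close>

definition unit_steps :: "(int ^ 'd::finite) set" where
  "unit_steps = {e. (\<Sum>j\<in>UNIV. \<bar>e $ j\<bar>) = 1}"

definition unit_steps_tuple :: "(int ^ 'd::finite ^ 'p::finite) set" where
  "unit_steps_tuple = {e. (\<Sum>i\<in>UNIV. \<Sum>j\<in>UNIV. \<bar>e $ i $ j\<bar>) = 1}"

text \<open>In the \<open>\<rho>\<close>-term, \<open>vec e\<close> is the tuple \<open>(e, \<dots>, e)\<close>.\<close>

definition hopping ::
    "real \<Rightarrow> real \<Rightarrow> (int ^ 'd::finite ^ 'p::finite \<Rightarrow> complex) \<Rightarrow> (int ^ 'd ^ 'p \<Rightarrow> complex)" where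
  "hopping \<kappa> \<rho> f x =
     of_real \<kappa> * (\<Sum>e\<in>unit_steps_tuple. f (x + e) - f x) +
     of_real \<rho> * (\<Sum>e\<in>unit_steps. f (x + vec e) - f x)"

definition potential ::
    "(int ^ 'd::finite ^ 'p::finite \<Rightarrow> complex) \<Rightarrow> (int ^ 'd ^ 'p \<Rightarrow> complex)" where
  "potential f x = (\<Sum>i\<in>UNIV. of_bool (x $ i = 0) * f x)"

definition hamiltonian ::
    "real \<Rightarrow> real \<Rightarrow> real \<Rightarrow>
     (int ^ 'd::finite ^ 'p::finite \<Rightarrow> complex) \<Rightarrow> (int ^ 'd ^ 'p \<Rightarrow> complex)" where
  "hamiltonian \<kappa> \<rho> \<gamma> f x = hopping \<kappa> \<rho> f x + of_real \<gamma> * potential f x"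


section \<open>The sums over unit vectors are finite and the operator is bounded\<close>

lemma finite_vec_box:
  assumes "finite S"
  shows "finite {e :: 'a ^ 'n::finite. \<forall>i. e $ i \<in> S}"
proof -
  have "{e :: 'a ^ 'n. \<forall>i. e $ i \<in> S} \<subseteq> vec_lambda ` (PiE UNIV (\<lambda>_. S))"
  proof
    fix e :: "'a ^ 'n" assume "e \<in> {e. \<forall>i. e $ i \<in> S}"
    then show "e \<in> vec_lambda ` (PiE UNIV (\<lambda>_. S))"
      by (intro image_eqI[where x = "vec_nth e"]) auto
  qed
  then show ?thesis
    using assms by (meson finite_PiE finite finite_imageI finite_subset)
qed

lemma finite_unit_steps: "finite (unit_steps :: (int ^ 'd::finite) set)"
proof -
  have "\<bar>e $ j\<bar> \<le> 1" if "e \<in> unit_steps" for e :: "int ^ 'd" and j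
    using that member_le_sum[of j UNIV "\<lambda>j. \<bar>e $ j\<bar>"] by (auto simp: unit_steps_def)
  then have "(unit_steps :: (int ^ 'd) set) \<subseteq> {e. \<forall>j. e $ j \<in> {-1..1}}"
    by (auto simp: abs_le_iff minus_le_iff)
  then show ?thesis
    using finite_vec_box[of "{-1..1::int}"] finite_subset by blast
qed

lemma finite_unit_steps_tuple:
  "finite (unit_steps_tuple :: (int ^ 'd::finite ^ 'p::finite) set)"
proof -
  have "\<bar>e $ i $ j\<bar> \<le> 1" if "e \<in> unit_steps_tuple" for e :: "int ^ 'd ^ 'p" and i j
  proof -
    have "\<bar>e $ i $ j\<bar> \<le> (\<Sum>j\<in>UNIV. \<bar>e $ i $ j\<bar>)"
      by (rule member_le_sum) auto
    also have "\<dots> \<le> (\<Sum>i\<in>UNIV. \<Sum>j\<in>UNIV. \<bar>e $ i $ j\<bar>)"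
      by (rule member_le_sum[of i UNIV "\<lambda>i. \<Sum>j\<in>UNIV. \<bar>e $ i $ j\<bar>"]) (auto intro: sum_nonneg)
    finally show ?thesis using that by (simp add: unit_steps_tuple_def)
  qed
  then have "(unit_steps_tuple :: (int ^ 'd ^ 'p) set)
      \<subseteq> {e. \<forall>i. e $ i \<in> {u. \<forall>j. u $ j \<in> {-1..1}}}"
    by (auto simp: abs_le_iff minus_le_iff)
  then show ?thesis
    using finite_vec_box[OF finite_vec_box[of "{-1..1::int}"]] finite_subset by blast
qed

lemma l2_norm_nonneg: "0 \<le> l2_norm f"
  by (simp add: l2_norm_def infsum_nonneg)

lemma l2_norm_squared: "(l2_norm f)\<^sup>2 = (\<Sum>\<^sub>\<infinity>x. (cmod (f x))\<^sup>2)"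
  by (simp add: l2_norm_def infsum_nonneg)

lemma l2_dominated:
  assumes "f \<in> l2" "g \<in> l2"
    and le: "\<And>x. (cmod (h x))\<^sup>2 \<le> K * (cmod (f x))\<^sup>2 + K * (cmod (g x))\<^sup>2"
  shows "h \<in> l2" "(l2_norm h)\<^sup>2 \<le> K * (l2_norm f)\<^sup>2 + K * (l2_norm g)\<^sup>2"
proof -
  have sf: "(\<lambda>x. K * (cmod (f x))\<^sup>2) summable_on UNIV" 
   and sg: "(\<lambda>x. K * (cmod (g x))\<^sup>2) summable_on UNIV"
    using assms(1,2) by (auto simp: l2_def intro: summable_on_cmult_right)
  have s: "(\<lambda>x. K * (cmod (f x))\<^sup>2 + K * (cmod (g x))\<^sup>2) summable_on UNIV"
    using sf sg by (rule summable_on_add)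
  have sh: "(\<lambda>x. (cmod (h x))\<^sup>2) summable_on UNIV"
    by (rule summable_on_comparison_test[OF s]) (use le in auto)
  then show "h \<in> l2" by (simp add: l2_def)
  have "(\<Sum>\<^sub>\<infinity>x. (cmod (h x))\<^sup>2) \<le> (\<Sum>\<^sub>\<infinity>x. K * (cmod (f x))\<^sup>2 + K * (cmod (g x))\<^sup>2)"
    by (rule infsum_mono[OF sh s]) (use le in auto)
  also have "\<dots> = K * (\<Sum>\<^sub>\<infinity>x. (cmod (f x))\<^sup>2) + K * (\<Sum>\<^sub>\<infinity>x. (cmod (g x))\<^sup>2)"
    by (simp only: infsum_add[OF sf sg] infsum_cmult_right')
  finally show "(l2_norm h)\<^sup>2 \<le> K * (l2_norm f)\<^sup>2 + K * (l2_norm g)\<^sup>2"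
    by (simp add: l2_norm_squared)
qed

lemma l2_add:
  assumes "f \<in> l2" "g \<in> l2"
  shows "(\<lambda>x. f x + g x) \<in> l2" "l2_norm (\<lambda>x. f x + g x) \<le> 2 * (l2_norm f + l2_norm g)"
proof -
  have le: "(cmod (f x + g x))\<^sup>2 \<le> 2 * (cmod (f x))\<^sup>2 + 2 * (cmod (g x))\<^sup>2" for x
  proof -
    have "(cmod (f x + g x))\<^sup>2 \<le> (cmod (f x) + cmod (g x))\<^sup>2"
      by (intro power_mono norm_triangle_ineq) auto
    also have "\<dots> \<le> 2 * (cmod (f x))\<^sup>2 + 2 * (cmod (g x))\<^sup>2"
      using zero_le_power2[of "cmod (f x) - cmod (g x)"] 
      by (simp add: power2_eq_square algebra_simps)
    finally show ?thesis .
  qed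
  show "(\<lambda>x. f x + g x) \<in> l2" by (rule l2_dominated(1)[OF assms le])
  have "(l2_norm (\<lambda>x. f x + g x))\<^sup>2 \<le> 2 * (l2_norm f)\<^sup>2 + 2 * (l2_norm g)\<^sup>2"
    by (rule l2_dominated(2)[OF assms le])
  also have "\<dots> \<le> (2 * (l2_norm f + l2_norm g))\<^sup>2"
    using l2_norm_nonneg[of f] l2_norm_nonneg[of g]
    by (simp add: power2_eq_square algebra_simps)
  finally show "l2_norm (\<lambda>x. f x + g x) \<le> 2 * (l2_norm f + l2_norm g)"
    by (rule power2_le_imp_le) (simp add: l2_norm_nonneg)
qed

lemma bounded_l2_op_add:
  assumes "bounded_l2_op S" "bounded_l2_op T"
  shows "bounded_l2_op (\<lambda>f x. S f x + T f x)"
proof -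
  obtain C D where C: "\<And>f. f \<in> l2 \<Longrightarrow> l2_norm (S f) \<le> C * l2_norm f"
    and D: "\<And>f. f \<in> l2 \<Longrightarrow> l2_norm (T f) \<le> D * l2_norm f"
    using assms unfolding bounded_l2_op_def by metis
  have "l2_norm (\<lambda>x. S f x + T f x) \<le> (2 * (C + D)) * l2_norm f" if "f \<in> l2" for f
  proof -
    have "l2_norm (\<lambda>x. S f x + T f x) \<le> 2 * (l2_norm (S f) + l2_norm (T f))"
      using assms that by (intro l2_add) (auto simp: bounded_l2_op_def)
    then show ?thesis using C[OF that] D[OF that] by (simp add: algebra_simps)
  qed
  then have "\<exists>K. \<forall>f\<in>l2. l2_norm (\<lambda>x. S f x + T f x) \<le> K * l2_norm f" by blast
  then show ?thesis
    using assms l2_add(1)[of "S f" "T f" for f] unfolding bounded_l2_op_def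
    by (simp add: algebra_simps)
qed

lemma bounded_l2_op_mult:
  fixes m :: "'a \<Rightarrow> complex"
  assumes "\<And>x. cmod (m x) \<le> C"
  shows "bounded_l2_op (\<lambda>f x. m x * f x)"
proof -
  have C0: "0 \<le> C" using assms[of undefined] norm_ge_zero order_trans by blast
  have le: "(cmod (m x * f x))\<^sup>2 \<le> C\<^sup>2 * (cmod (f x))\<^sup>2 + C\<^sup>2 * (cmod (0 :: complex))\<^sup>2"
    for f :: "'a \<Rightarrow> complex" and x
    using assms[of x] by (simp add: norm_mult power_mult_distrib mult_right_mono power_mono)
  have z: "(\<lambda>_::'a. 0) \<in> l2" by (simp add: l2_def)
  have mem: "(\<lambda>x. m x * f x) \<in> l2" if "f \<in> l2" for f
    by (rule l2_dominated(1)[where f = f and g = "\<lambda>_. 0" and K = "C\<^sup>2", OF that z le[of _ f]])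
  have "l2_norm (\<lambda>x. m x * f x) \<le> C * l2_norm f" if "f \<in> l2" for f
  proof -
    have "(l2_norm (\<lambda>x. m x * f x))\<^sup>2 \<le> (C * l2_norm f)\<^sup>2"
      using l2_dominated(2)[where f = f and g = "\<lambda>_. 0" and K = "C\<^sup>2" and h = "\<lambda>x. m x * f x", OF that z le[of _ f]]
      by (simp add: power_mult_distrib l2_norm_def[of "\<lambda>_. 0"])
    then show ?thesis by (rule power2_le_imp_le) (simp add: C0 l2_norm_nonneg)
  qed
  then have "\<exists>K. \<forall>f\<in>l2. l2_norm (\<lambda>x. m x * f x) \<le> K * l2_norm f" by blast
  then show ?thesis
    using mem unfolding bounded_l2_op_def by (simp add: algebra_simps)
qed

lemma bounded_l2_op_translate:
  fixes a :: "'a::ab_group_add"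
  shows "bounded_l2_op (\<lambda>f x. f (x + a))"
proof -
  have b: "bij_betw (\<lambda>x. x + a) UNIV UNIV"
    by (rule bij_betwI[where g = "\<lambda>x. x - a"]) auto
  have "(\<lambda>x. f (x + a)) \<in> l2" if "f \<in> l2" for f :: "'a \<Rightarrow> complex"
    using that summable_on_reindex_bij_betw[OF b, of "\<lambda>x. (cmod (f x))\<^sup>2"]
    by (simp add: l2_def)
  moreover have "l2_norm (\<lambda>x. f (x + a)) = l2_norm f" for f :: "'a \<Rightarrow> complex"
    using infsum_reindex_bij_betw[OF b, of "\<lambda>x. (cmod (f x))\<^sup>2"]
    by (simp add: l2_norm_def)
  ultimately show ?thesis
    unfolding bounded_l2_op_def by (auto intro: exI[of _ 1])
qed

lemma bounded_l2_op_sum: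
  assumes "finite I" "\<And>i. i \<in> I \<Longrightarrow> bounded_l2_op (T i)"
  shows "bounded_l2_op (\<lambda>f x. \<Sum>i\<in>I. T i f x)"
  using assms
proof (induction I rule: finite_induct)
  case empty
  then show ?case using bounded_l2_op_mult[of "\<lambda>_. 0" 0] by simp
next
  case (insert i I)
  then show ?case using bounded_l2_op_add[of "T i" "\<lambda>f x. \<Sum>i\<in>I. T i f x"] by simp
qed

lemma bounded_l2_op_scale:
  assumes "bounded_l2_op T"
  shows "bounded_l2_op (\<lambda>f x. c * T f x)"
proof -
  have M: "bounded_l2_op (\<lambda>f x. c * f x :: complex)" for c :: complex
    by (rule bounded_l2_op_mult[of "\<lambda>_. c" "cmod c"]) simp
  obtain C where C: "\<And>f. f \<in> l2 \<Longrightarrow> l2_norm (T f) \<le> C * l2_norm f"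
    using assms unfolding bounded_l2_op_def by metis
  obtain D where D: "\<And>f :: 'a \<Rightarrow> complex. f \<in> l2 \<Longrightarrow> l2_norm (\<lambda>x. c * f x) \<le> D * l2_norm f"
    using M[of c] unfolding bounded_l2_op_def by metis
  have "l2_norm (\<lambda>x. c * T f x) \<le> (\<bar>D\<bar> * C) * l2_norm f" if "f \<in> l2" for f
  proof -
    have "l2_norm (\<lambda>x. c * T f x) \<le> D * l2_norm (T f)"
      using assms that by (intro D) (auto simp: bounded_l2_op_def)
    also have "\<dots> \<le> \<bar>D\<bar> * l2_norm (T f)"
      by (intro mult_right_mono l2_norm_nonneg) simp
    also have "\<dots> \<le> \<bar>D\<bar> * (C * l2_norm f)"
      using C[OF that] by (intro mult_left_mono) auto
    finally show ?thesis by (simp add: mult.assoc)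
  qed
  moreover have mem: "(\<lambda>x. c * T f x) \<in> l2" if "f \<in> l2" for f
    using assms M[of c] that unfolding bounded_l2_op_def by blast
  ultimately have "\<exists>K. \<forall>f\<in>l2. l2_norm (\<lambda>x. c * T f x) \<le> K * l2_norm f" by blast
  then show ?thesis
    using assms mem unfolding bounded_l2_op_def
    by (simp add: algebra_simps)
qed

lemma bounded_l2_op_hamiltonian:
  "bounded_l2_op (hamiltonian \<kappa> \<rho> \<gamma> ::
     (int ^ 'd::finite ^ 'p::finite \<Rightarrow> complex) \<Rightarrow> (int ^ 'd ^ 'p \<Rightarrow> complex))"
proof -
  have diff: "bounded_l2_op (\<lambda>(f :: int ^ 'd ^ 'p \<Rightarrow> complex) x. f (x + a) - f x)" for a
    using bounded_l2_op_add[OF bounded_l2_op_translate[of a]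
        bounded_l2_op_mult[of "\<lambda>_. -1" 1]] by simp
  have pot: "bounded_l2_op (\<lambda>(f :: int ^ 'd ^ 'p \<Rightarrow> complex) x. of_bool (x $ i = 0) * f x)" for i
    by (rule bounded_l2_op_mult[where C = 1]) simp
  show ?thesis
    unfolding hamiltonian_def[abs_def] hopping_def potential_def
    by (intro bounded_l2_op_add bounded_l2_op_scale bounded_l2_op_sum diff pot
        finite_unit_steps finite_unit_steps_tuple finite)
qed

end

theory Submission
  imports Defs
begin

text \<open>The potential takes its maximal value \<open>p\<close> only at the origin and is at most \<open>p - 1\<close>
  elsewhere. Let \<open>P\<close> be the projection onto the delta function at the origin and \<open>c\<close> the total
  jump rate. Then \<open>H = K + \<gamma> P - c\<close>, where \<open>K\<close> has nonnegative matrix entries and norm at most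
  \<open>r = c + \<gamma> (p - 1)\<close>, and \<open>r < \<gamma> p\<close> because \<open>c < \<gamma>\<close>. For \<open>\<bar>w\<bar> > r\<close> the Neumann series inverts
  \<open>w - K\<close>, so \<open>w - c\<close> is in the spectrum of the rank-one perturbation \<open>H\<close> only if
  \<open>\<gamma> \<langle>\<delta>, (w - K)\<^sup>-\<^sup>1 \<delta>\<rangle> = 1\<close>. The left side is a power series in \<open>1 / w\<close> with nonnegative
  coefficients that is at least \<open>1\<close> at \<open>w = \<gamma> p\<close>; hence the equation has a root \<open>W \<ge> \<gamma> p\<close> that is
  isolated and dominates all other roots in modulus. The eigenspace of \<open>W - c\<close> is spanned by
  \<open>(W - K)\<^sup>-\<^sup>1 \<delta>\<close>, which is positive since the lattice is connected.\<close>

section \<open>The norm of square-summable functions\<close>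

lemma L2_set_le_l2_norm:
  assumes "f \<in> l2" "finite S"
  shows "L2_set (\<lambda>x. cmod (f x)) S \<le> l2_norm f"
  unfolding L2_set_def l2_norm_def
  using assms by (intro real_sqrt_le_mono finite_sum_le_infsum) (auto simp: l2_def)

lemma cmod_le_l2_norm: "f \<in> l2 \<Longrightarrow> cmod (f x) \<le> l2_norm f"
  using L2_set_le_l2_norm[of f "{x}"] by simp

text \<open>Together with \<open>L2_set_le_l2_norm\<close> this transfers inequalities for
  \<open>L2_set\<close> on finite sets to \<open>l2_norm\<close>.\<close>

lemma l2_normI:
  assumes "\<And>S. finite S \<Longrightarrow> L2_set (\<lambda>x. cmod (f x)) S \<le> C"
  shows "f \<in> l2" "l2_norm f \<le> C"
proof -
  have C: "0 \<le> C" using assms[of "{}"] by simp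
  have le: "(\<Sum>x\<in>S. (cmod (f x))\<^sup>2) \<le> C\<^sup>2" if "finite S" for S
    using assms[OF that] C unfolding L2_set_def by (metis real_sqrt_le_iff real_sqrt_abs abs_of_nonneg)
  have s: "(\<lambda>x. (cmod (f x))\<^sup>2) summable_on UNIV"
    by (rule nonneg_bdd_above_summable_on) (auto intro!: bdd_aboveI[of _ "C\<^sup>2"] le)
  then show "f \<in> l2" by (simp add: l2_def)
  have "(\<Sum>\<^sub>\<infinity>x. (cmod (f x))\<^sup>2) \<le> C\<^sup>2"
    by (rule infsum_le_finite_sums[OF s]) (rule le)
  then show "l2_norm f \<le> C"
    unfolding l2_norm_def using C by (metis real_sqrt_le_iff real_sqrt_abs abs_of_nonneg)
qed

text \<open>Minkowski's inequality with constant 1. The factor 2 in \<open>l2_add\<close> would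
  spoil the bound \<open>r\<close> on \<open>K\<close>, whose exact size matters for the spectral
  gap.\<close>

lemma l2_norm_triangle:
  assumes "f \<in> l2" "g \<in> l2"
  shows "l2_norm (\<lambda>x. f x + g x) \<le> l2_norm f + l2_norm g"
proof (rule l2_normI(2))
  fix S :: "'a set" assume S: "finite S"
  have "L2_set (\<lambda>x. cmod (f x + g x)) S \<le> L2_set (\<lambda>x. cmod (f x) + cmod (g x)) S"
    by (intro L2_set_mono norm_triangle_ineq) auto
  also have "\<dots> \<le> L2_set (\<lambda>x. cmod (f x)) S + L2_set (\<lambda>x. cmod (g x)) S"
    by (rule L2_set_triangle_ineq)
  also have "\<dots> \<le> l2_norm f + l2_norm g"
    using assms S by (intro add_mono L2_set_le_l2_norm)
  finally show "L2_set (\<lambda>x. cmod (f x + g x)) S \<le> l2_norm f + l2_norm g" .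
qed

lemma l2_zero: "(\<lambda>x. 0) \<in> l2" and l2_norm_zero: "l2_norm (\<lambda>x. 0) = 0"
  by (auto simp: l2_def l2_norm_def)

lemma l2_scale: "f \<in> l2 \<Longrightarrow> (\<lambda>x. c * f x) \<in> l2" for f :: "'a \<Rightarrow> complex"
  using bounded_l2_op_mult[of "\<lambda>_::'a. c" "cmod c"] unfolding bounded_l2_op_def by blast

lemma l2_norm_scale: "l2_norm (\<lambda>x. c * f x) = cmod c * l2_norm f"
  by (simp add: l2_norm_def norm_mult power_mult_distrib infsum_cmult_right' real_sqrt_mult)

lemma l2_norm_mult_le:
  assumes "\<And>x. cmod (m x) \<le> C" "f \<in> l2"
  shows "l2_norm (\<lambda>x. m x * f x) \<le> C * l2_norm f"
proof (rule l2_normI(2))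
  fix S :: "'a set" assume S: "finite S"
  have C: "0 \<le> C" using assms(1)[of undefined] norm_ge_zero order_trans by blast
  have "L2_set (\<lambda>x. cmod (m x * f x)) S \<le> L2_set (\<lambda>x. C * cmod (f x)) S"
    using assms(1) by (intro L2_set_mono) (auto simp: norm_mult mult_right_mono)
  also have "\<dots> = C * L2_set (\<lambda>x. cmod (f x)) S"
    using C by (simp add: L2_set_right_distrib)
  also have "\<dots> \<le> C * l2_norm f"
    using assms(2) S C by (intro mult_left_mono L2_set_le_l2_norm)
  finally show "L2_set (\<lambda>x. cmod (m x * f x)) S \<le> C * l2_norm f" .
qed

lemma l2_sum:
  assumes "\<And>i. i \<in> I \<Longrightarrow> F i \<in> l2"
  shows "(\<lambda>x. \<Sum>i\<in>I. F i x) \<in> l2 \<and> l2_norm (\<lambda>x. \<Sum>i\<in>I. F i x) \<le> (\<Sum>i\<in>I. l2_norm (F i))"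
  using assms
proof (induction I rule: infinite_finite_induct)
  case (insert i I)
  have "l2_norm (\<lambda>x. F i x + (\<Sum>i\<in>I. F i x)) \<le> l2_norm (F i) + l2_norm (\<lambda>x. \<Sum>i\<in>I. F i x)"
    using insert by (intro l2_norm_triangle) auto
  then show ?case
    using insert l2_add(1)[of "F i" "\<lambda>x. \<Sum>i\<in>I. F i x"] by fastforce
qed (simp_all add: l2_zero l2_norm_zero)

lemma l2_norm_translate:
  fixes f :: "'a::ab_group_add \<Rightarrow> complex"
  shows "l2_norm (\<lambda>x. f (x + a)) = l2_norm f"
proof -
  have "bij_betw (\<lambda>x. x + a) UNIV UNIV"
    by (rule bij_betwI[where g = "\<lambda>x. x - a"]) auto
  from infsum_reindex_bij_betw[OF this, of "\<lambda>x. (cmod (f x))\<^sup>2"] show ?thesis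
    by (simp add: l2_norm_def)
qed

text \<open>A Fatou-type argument: on a finite set the norm depends continuously on finitely many
  values, so a uniform bound passes to the limit. It is used for the partial sums of the Neumann
  series.\<close>

lemma l2_pointwise_limit:
  assumes "\<And>x. (\<lambda>n. F n x) \<longlonglongrightarrow> f x" "\<And>n. F n \<in> l2" "\<And>n. l2_norm (F n) \<le> C"
  shows "f \<in> l2" "l2_norm f \<le> C"
proof -
  have "L2_set (\<lambda>x. cmod (f x)) S \<le> C" if "finite S" for S
  proof (rule LIMSEQ_le_const2)
    show "(\<lambda>n. L2_set (\<lambda>x. cmod (F n x)) S) \<longlonglongrightarrow> L2_set (\<lambda>x. cmod (f x)) S"
      unfolding L2_set_def by (intro tendsto_intros assms)
    show "\<exists>N. \<forall>n\<ge>N. L2_set (\<lambda>x. cmod (F n x)) S \<le> C"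
      using L2_set_le_l2_norm[OF assms(2) that] assms(3) order_trans by blast
  qed
  then show "f \<in> l2" "l2_norm f \<le> C" by (auto intro: l2_normI)
qed

definition l2_delta :: "'a \<Rightarrow> 'a \<Rightarrow> complex" where
  "l2_delta a x = of_bool (x = a)"

lemma l2_delta: "l2_delta a \<in> l2" "l2_norm (l2_delta a) \<le> 1"
proof -
  have "L2_set (\<lambda>x. cmod (l2_delta a x)) S \<le> 1" if "finite S" for S
  proof -
    have "(\<Sum>x\<in>S. (cmod (l2_delta a x))\<^sup>2) = (\<Sum>x\<in>S. if x = a then 1 else 0)"
      by (intro sum.cong) (auto simp: l2_delta_def)
    then show ?thesis using that by (simp add: L2_set_def sum.delta)
  qed
  then show "l2_delta a \<in> l2" "l2_norm (l2_delta a) \<le> 1" by (auto intro: l2_normI)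
qed

section \<open>Composition, rank-one operators and eigenvalues\<close>

lemma bounded_l2_op_zero:
  assumes "bounded_l2_op T"
  shows "T (\<lambda>x. 0) = (\<lambda>x. 0)"
proof -
  have "T (\<lambda>x. c * f x) = (\<lambda>x. c * T f x)" if "f \<in> l2" for c f
    using assms that unfolding bounded_l2_op_def by blast
  from this[OF l2_zero, of 0] show ?thesis by simp
qed

lemma bounded_l2_op_comp:
  assumes S: "bounded_l2_op S" and T: "bounded_l2_op T"
  shows "bounded_l2_op (\<lambda>f. S (T f))"
proof -
  obtain C where C: "\<And>f. f \<in> l2 \<Longrightarrow> l2_norm (S f) \<le> C * l2_norm f"
    using S unfolding bounded_l2_op_def by blast
  obtain D where D: "\<And>f. f \<in> l2 \<Longrightarrow> l2_norm (T f) \<le> D * l2_norm f"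
    using T unfolding bounded_l2_op_def by blast
  have mem: "T f \<in> l2" if "f \<in> l2" for f
    using T that unfolding bounded_l2_op_def by blast
  have "l2_norm (S (T f)) \<le> (\<bar>C\<bar> * D) * l2_norm f" if f: "f \<in> l2" for f
  proof -
    have "l2_norm (S (T f)) \<le> C * l2_norm (T f)" by (rule C[OF mem[OF f]])
    also have "\<dots> \<le> \<bar>C\<bar> * l2_norm (T f)"
      by (intro mult_right_mono l2_norm_nonneg) simp
    also have "\<dots> \<le> \<bar>C\<bar> * (D * l2_norm f)"
      by (intro mult_left_mono D f) simp
    finally show ?thesis by (simp add: mult.assoc)
  qed
  then have "\<exists>K. \<forall>f\<in>l2. l2_norm (S (T f)) \<le> K * l2_norm f" by blast
  with S T show ?thesis
    unfolding bounded_l2_op_def by simp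
qed

text \<open>Evaluation at a point is a functional of norm at most 1 on \<open>l2\<close>, so this
  rank-one operator has norm at most \<open>l2_norm v\<close>.\<close>

lemma bounded_l2_op_eval:
  assumes "v \<in> l2"
  shows "bounded_l2_op (\<lambda>f x. f a * v x)"
proof -
  have "l2_norm (\<lambda>x. f a * v x) \<le> l2_norm v * l2_norm f" if "f \<in> l2" for f
    using mult_right_mono[OF cmod_le_l2_norm[OF that, of a] l2_norm_nonneg[of v]]
    by (simp add: l2_norm_scale mult.commute)
  then have "\<exists>C. \<forall>f\<in>l2. l2_norm (\<lambda>x. f a * v x) \<le> C * l2_norm f" by blast
  then show ?thesis
    using l2_scale[OF assms] by (simp add: bounded_l2_op_def algebra_simps)
qed

text \<open>\<open>T - z\<close> sends an eigenvector to 0, and a linear left inverse cannot send 0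
  back to a nonzero function.\<close>

lemma l2_point_spectrum_subset:
  assumes "bounded_l2_op T"
  shows "l2_point_spectrum T \<subseteq> l2_spectrum T"
proof
  fix z assume "z \<in> l2_point_spectrum T"
  then obtain f where f: "f \<in> l2" "T f = (\<lambda>x. z * f x)" "f \<noteq> (\<lambda>x. 0)"
    by (auto simp: l2_point_spectrum_def l2_eigenspace_def)
  have False if "bounded_l2_op R" "\<forall>f\<in>l2. R (\<lambda>x. T f x - z * f x) = f" for R
    using that(2) f bounded_l2_op_zero[OF that(1)] by fastforce
  then show "z \<in> l2_spectrum T"
    by (auto simp: l2_spectrum_def l2_resolvent_set_def)
qed


section \<open>The Neumann series\<close>

text \<open>Candidate for \<open>(w - K)\<^sup>-\<^sup>1 f\<close>. The series is summed separately
  at each point, so only convergence of complex numbers is involved.\<close>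

definition neumann ::
    "(('a \<Rightarrow> complex) \<Rightarrow> ('a \<Rightarrow> complex)) \<Rightarrow> complex \<Rightarrow> ('a \<Rightarrow> complex) \<Rightarrow> ('a \<Rightarrow> complex)" where
  "neumann K w f x = (\<Sum>n. (K ^^ n) f x / w ^ Suc n)"

locale l2_op_bound =
  fixes K :: "('a \<Rightarrow> complex) \<Rightarrow> ('a \<Rightarrow> complex)" and r :: real
  assumes bounded: "bounded_l2_op K"
    and norm_le: "\<And>f. f \<in> l2 \<Longrightarrow> l2_norm (K f) \<le> r * l2_norm f"
    and r_nonneg: "0 \<le> r"
begin

lemma op_l2: "f \<in> l2 \<Longrightarrow> K f \<in> l2"
  and op_add: "f \<in> l2 \<Longrightarrow> g \<in> l2 \<Longrightarrow> K (\<lambda>x. f x + g x) = (\<lambda>x. K f x + K g x)"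
  and op_scale: "f \<in> l2 \<Longrightarrow> K (\<lambda>x. c * f x) = (\<lambda>x. c * K f x)"
  using bounded unfolding bounded_l2_op_def by blast+

lemma iter_l2: "f \<in> l2 \<Longrightarrow> (K ^^ n) f \<in> l2"
  by (induction n) (auto intro: op_l2)

lemma iter_norm:
  assumes "f \<in> l2"
  shows "l2_norm ((K ^^ n) f) \<le> r ^ n * l2_norm f"
proof (induction n)
  case (Suc n)
  have "l2_norm ((K ^^ Suc n) f) \<le> r * l2_norm ((K ^^ n) f)"
    using norm_le[OF iter_l2[OF assms]] by simp
  also have "\<dots> \<le> r * (r ^ n * l2_norm f)"
    using Suc r_nonneg by (intro mult_left_mono)
  finally show ?case by (simp add: mult.assoc)
qed simp

lemma iter_add:
  assumes "f \<in> l2" "g \<in> l2"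
  shows "(K ^^ n) (\<lambda>x. f x + g x) = (\<lambda>x. (K ^^ n) f x + (K ^^ n) g x)"
  by (induction n) (use assms in \<open>auto simp: op_add iter_l2\<close>)

lemma iter_scale:
  assumes "f \<in> l2"
  shows "(K ^^ n) (\<lambda>x. c * f x) = (\<lambda>x. c * (K ^^ n) f x)"
  by (induction n) (use assms in \<open>auto simp: op_scale iter_l2\<close>)

context
  fixes w :: complex
  assumes w: "r < cmod w"
begin

lemma w_nonzero: "w \<noteq> 0"
  using w r_nonneg by auto

text \<open>A geometric series of ratio \<open>r / cmod w\<close>; with \<open>C = l2_norm f\<close>
  its value becomes the resolvent bound.\<close>

lemma majorant_sums:
  "(\<lambda>n. r ^ n * C / cmod w ^ Suc n) sums (C / (cmod w - r))"
proof -
  have "(\<lambda>n. (C / cmod w) * (r / cmod w) ^ n) sums ((C / cmod w) * (1 / (1 - r / cmod w)))"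
    using w r_nonneg by (intro sums_mult geometric_sums) (simp add: divide_less_eq)
  moreover have "(C / cmod w) * (1 / (1 - r / cmod w)) = C / (cmod w - r)"
    using w r_nonneg w_nonzero by (simp add: field_simps)
  moreover have "(C / cmod w) * (r / cmod w) ^ n = r ^ n * C / cmod w ^ Suc n" for n
    by (simp add: power_divide)
  ultimately show ?thesis by (simp only:)
qed

lemma term_norm:
  assumes "f \<in> l2"
  shows "l2_norm (\<lambda>x. (K ^^ n) f x / w ^ Suc n) \<le> r ^ n * l2_norm f / cmod w ^ Suc n"
proof -
  have "l2_norm (\<lambda>x. (K ^^ n) f x / w ^ Suc n) = l2_norm ((K ^^ n) f) / cmod w ^ Suc n"
    using l2_norm_scale[of "1 / w ^ Suc n" "(K ^^ n) f"] by (simp add: norm_divide norm_mult norm_power)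
  then show ?thesis
    using divide_right_mono[OF iter_norm[OF assms, of n], of "cmod w ^ Suc n"] by simp
qed

lemma term_l2:
  assumes "f \<in> l2"
  shows "(\<lambda>x. (K ^^ n) f x / w ^ Suc n) \<in> l2"
  using l2_scale[OF iter_l2[OF assms, of n], of "1 / w ^ Suc n"] by simp

lemma neumann_sums:
  assumes "f \<in> l2"
  shows "(\<lambda>n. (K ^^ n) f x / w ^ Suc n) sums neumann K w f x"
  unfolding neumann_def
proof (rule summable_sums, rule summable_comparison_test')
  show "summable (\<lambda>n. r ^ n * l2_norm f / cmod w ^ Suc n)"
    using majorant_sums by (rule sums_summable)
  show "norm ((K ^^ n) f x / w ^ Suc n) \<le> r ^ n * l2_norm f / cmod w ^ Suc n" if "n \<ge> 0" for n
    using cmod_le_l2_norm[OF term_l2[OF assms, of n], of x] term_norm[OF assms, of n] by linarith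
qed

text \<open>The triangle inequality bounds every partial sum by the geometric majorant, and
  \<open>l2_pointwise_limit\<close> carries membership and bound over to the pointwise sum.\<close>

lemma neumann_l2:
  assumes "f \<in> l2"
  shows "neumann K w f \<in> l2" "l2_norm (neumann K w f) \<le> l2_norm f / (cmod w - r)"
proof -
  let ?F = "\<lambda>N x. \<Sum>n<N. (K ^^ n) f x / w ^ Suc n"
  have lim: "(\<lambda>N. ?F N x) \<longlonglongrightarrow> neumann K w f x" for x
    using neumann_sums[OF assms] by (simp add: sums_def)
  have mem: "?F N \<in> l2" for N
    using l2_sum[of "{..<N}" "\<lambda>n x. (K ^^ n) f x / w ^ Suc n"] term_l2[OF assms] by blast
  have le: "l2_norm (?F N) \<le> l2_norm f / (cmod w - r)" for N
  proof -
    have "l2_norm (?F N) \<le> (\<Sum>n<N. l2_norm (\<lambda>x. (K ^^ n) f x / w ^ Suc n))"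
      using l2_sum[of "{..<N}" "\<lambda>n x. (K ^^ n) f x / w ^ Suc n"] term_l2[OF assms] by blast
    also have "\<dots> \<le> (\<Sum>n<N. r ^ n * l2_norm f / cmod w ^ Suc n)"
      by (intro sum_mono term_norm assms)
    also have "\<dots> \<le> l2_norm f / (cmod w - r)"
      unfolding sums_unique[OF majorant_sums]
      by (rule sum_le_suminf[OF sums_summable[OF majorant_sums]])
        (auto intro!: divide_nonneg_nonneg mult_nonneg_nonneg simp: r_nonneg l2_norm_nonneg)
    finally show ?thesis .
  qed
  from l2_pointwise_limit[OF lim mem le]
  show "neumann K w f \<in> l2" "l2_norm (neumann K w f) \<le> l2_norm f / (cmod w - r)" .
qed

lemma neumann_add:
  assumes "f \<in> l2" "g \<in> l2"
  shows "neumann K w (\<lambda>x. f x + g x) = (\<lambda>x. neumann K w f x + neumann K w g x)"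
proof
  fix x
  show "neumann K w (\<lambda>x. f x + g x) x = neumann K w f x + neumann K w g x"
    using neumann_sums[OF l2_add(1)[OF assms], of x]
      sums_add[OF neumann_sums[OF assms(1), of x] neumann_sums[OF assms(2), of x]]
    by (simp add: iter_add[OF assms] add_divide_distrib sums_unique2)
qed

lemma neumann_scale:
  assumes "f \<in> l2"
  shows "neumann K w (\<lambda>x. c * f x) = (\<lambda>x. c * neumann K w f x)"
proof
  fix x
  have "(\<lambda>n. (K ^^ n) (\<lambda>x. c * f x) x / w ^ Suc n) sums (c * neumann K w f x)"
    using sums_mult[OF neumann_sums[OF assms, of x], of c] by (simp add: iter_scale[OF assms])
  then show "neumann K w (\<lambda>x. c * f x) x = c * neumann K w f x"
    using neumann_sums[OF l2_scale[OF assms]] sums_unique2 by blast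
qed

lemma bounded_neumann: "bounded_l2_op (neumann K w)"
  unfolding bounded_l2_op_def
  by (intro conjI ballI allI exI[of _ "1 / (cmod w - r)"])
    (use neumann_l2 in \<open>simp_all add: neumann_add neumann_scale\<close>)

text \<open>An index shift of the series. By linearity it says that the Neumann series is a left
  inverse of \<open>w - K\<close>; the right inverse needs commutation with \<open>K\<close> in
  addition.\<close>

lemma neumann_step:
  assumes "f \<in> l2"
  shows "w * neumann K w f x = f x + neumann K w (K f) x"
proof -
  have "(\<lambda>n. (K ^^ Suc n) f x / w ^ Suc (Suc n)) sums (neumann K w f x - f x / w)"
    using sums_Suc_iff[of "\<lambda>n. (K ^^ n) f x / w ^ Suc n"] neumann_sums[OF assms, of x] by simp
  from sums_mult[OF this, of w]
  have "(\<lambda>n. (K ^^ n) (K f) x / w ^ Suc n) sums (w * (neumann K w f x - f x / w))"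
    using w_nonzero by (simp add: funpow_swap1)
  from sums_unique2[OF this neumann_sums[OF op_l2[OF assms]]]
  show ?thesis using w_nonzero by (simp add: algebra_simps)
qed

text \<open>The commutator \<open>D = K N - N K\<close> with the Neumann series \<open>N\<close> satisfies
  \<open>w D f = D (K f)\<close>, so \<open>D\<close> is of size \<open>(r / \<bar>w\<bar>)\<^sup>n\<close> for every \<open>n\<close>.\<close>

lemma neumann_commute:
  assumes "f \<in> l2"
  shows "K (neumann K w f) x = neumann K w (K f) x"
proof -
  \<comment> \<open>The commutator evaluated at the fixed point \<open>x\<close>. Pointwise
    convergence alone does not justify applying \<open>K\<close> term by term.\<close>
  define D where "D f = K (neumann K w f) x - neumann K w (K f) x" for f
  have step: "w * D f = D (K f)" if f: "f \<in> l2" for f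
  proof -
    have "w * K (neumann K w f) x = K (\<lambda>x. w * neumann K w f x) x"
      using op_scale[OF neumann_l2(1)[OF f], of w] by simp
    also have "\<dots> = K f x + K (neumann K w (K f)) x"
      using f by (simp add: neumann_step op_add neumann_l2(1) op_l2)
    finally show ?thesis
      using neumann_step[OF op_l2[OF f], of x] by (simp add: D_def algebra_simps)
  qed
  have iter: "w ^ n * D f = D ((K ^^ n) f)" for n
  proof (induction n)
    case (Suc n)
    then show ?case using step[OF iter_l2[OF assms, of n]] by (simp add: mult.assoc)
  qed simp
  \<comment> \<open>Each of the two products in the commutator contributes
    \<open>r / (cmod w - r)\<close>.\<close>
  define C where "C = 2 * r / (cmod w - r)"
  have D_le: "cmod (D g) \<le> C * l2_norm g" if g: "g \<in> l2" for g
  proof -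
    have "cmod (K (neumann K w g) x) \<le> l2_norm (K (neumann K w g))"
      using g by (intro cmod_le_l2_norm op_l2 neumann_l2)
    also have "\<dots> \<le> r * l2_norm (neumann K w g)"
      using g by (intro norm_le neumann_l2)
    also have "\<dots> \<le> r * (l2_norm g / (cmod w - r))"
      using g r_nonneg by (intro mult_left_mono neumann_l2)
    finally have 1: "cmod (K (neumann K w g) x) \<le> r * (l2_norm g / (cmod w - r))" .
    have "cmod (neumann K w (K g) x) \<le> l2_norm (neumann K w (K g))"
      using g by (intro cmod_le_l2_norm op_l2 neumann_l2)
    also have "\<dots> \<le> l2_norm (K g) / (cmod w - r)"
      using g by (intro neumann_l2 op_l2)
    also have "\<dots> \<le> r * l2_norm g / (cmod w - r)"
      using g w by (intro divide_right_mono norm_le) auto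
    finally have "cmod (neumann K w (K g) x) \<le> r * l2_norm g / (cmod w - r)" .
    moreover have "C * l2_norm g = r * (l2_norm g / (cmod w - r)) + r * l2_norm g / (cmod w - r)"
      by (simp add: C_def)
    ultimately show ?thesis
      using 1 norm_triangle_ineq4[of "K (neumann K w g) x" "neumann K w (K g) x"]
      unfolding D_def by linarith
  qed
  have C: "0 \<le> C" using w r_nonneg by (simp add: C_def)
  have "cmod (D f) \<le> C * l2_norm f * (r / cmod w) ^ n" for n
  proof -
    have "cmod w ^ n * cmod (D f) = cmod (D ((K ^^ n) f))"
      by (metis iter norm_mult norm_power)
    also have "\<dots> \<le> C * (r ^ n * l2_norm f)"
      using D_le[OF iter_l2[OF assms]] mult_left_mono[OF iter_norm[OF assms] C] order_trans by blast
    finally show ?thesis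
      using w_nonzero by (simp add: power_divide field_simps)
  qed
  moreover have "(\<lambda>n. C * l2_norm f * (r / cmod w) ^ n) \<longlonglongrightarrow> C * l2_norm f * 0"
    using w r_nonneg by (intro tendsto_intros LIMSEQ_power_zero) (simp add: divide_less_eq)
  ultimately have "cmod (D f) \<le> 0"
    by (metis (no_types, lifting) LIMSEQ_le_const mult_zero_right)
  then show ?thesis by (simp add: D_def)
qed

lemma neumann_right:
  "f \<in> l2 \<Longrightarrow> w * neumann K w f x - K (neumann K w f) x = f x"
  by (simp add: neumann_commute neumann_step)

lemma neumann_left:
  assumes "f \<in> l2"
  shows "neumann K w (\<lambda>x. w * f x - K f x) = f"
proof -
  \<comment> \<open>The difference is written with the scalar -1 so that \<open>neumann_add\<close>
    and \<open>neumann_scale\<close> apply.\<close>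
  have "neumann K w (\<lambda>x. w * f x + (-1) * K f x) =
      (\<lambda>x. w * neumann K w f x + (-1) * neumann K w (K f) x)"
    by (simp only: neumann_add[OF l2_scale[OF assms] l2_scale[OF op_l2[OF assms]]]
        neumann_scale[OF assms] neumann_scale[OF op_l2[OF assms]])
  then show ?thesis using neumann_step[OF assms] by simp
qed

end

end


section \<open>Power series with nonnegative coefficients\<close>

text \<open>On \<open>[0, R)\<close> the series is strictly increasing because
  \<open>b 1 > 0\<close>, and its modulus at \<open>z\<close> is at most its value at
  \<open>cmod z\<close>. The intermediate value theorem gives the root \<open>s\<close>, domination
  excludes roots of smaller modulus, and a positive derivative isolates \<open>s\<close>.
  Convergence at \<open>R > t\<close> ensures differentiability on all of
  \<open>[0, t]\<close>.\<close>

lemma nonneg_power_series_root: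
  fixes b :: "nat \<Rightarrow> real" and R t y :: real
  assumes nonneg: "\<And>n. 0 \<le> b n" and b1: "0 < b 1"
    and summable: "summable (\<lambda>n. b n * R ^ n)"
    and t: "0 < t" "t < R" and y: "b 0 < y" "y \<le> (\<Sum>n. b n * t ^ n)"
  obtains s where "0 < s" "s \<le> t" "(\<Sum>n. of_real (b n) * of_real s ^ n) = complex_of_real y"
    and "\<And>z. cmod z < s \<Longrightarrow> (\<Sum>n. of_real (b n) * z ^ n) \<noteq> complex_of_real y"
    and "\<forall>\<^sub>F z in at (complex_of_real s). (\<Sum>n. of_real (b n) * z ^ n) \<noteq> complex_of_real y"
proof -
  define \<phi> where "\<phi> s = (\<Sum>n. b n * s ^ n)" for s
  define \<Phi> where "\<Phi> z = (\<Sum>n. complex_of_real (b n) * z ^ n)" for z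
  have R: "0 < R" using t by simp
  have sum_norm: "summable (\<lambda>n. b n * \<bar>s\<bar> ^ n)" if "\<bar>s\<bar> < R" for s
    using powser_insidea[OF summable, of s] that R nonneg by (simp add: abs_mult power_abs)
  have sum_real: "summable (\<lambda>n. b n * s ^ n)" if "\<bar>s\<bar> < R" for s
    using powser_inside[OF summable, of s] that R by simp
  have sum_R: "summable (\<lambda>n. complex_of_real (b n) * of_real R ^ n)"
    using summable_of_real[OF summable, where 'a = complex] by simp
  have \<Phi>_real: "\<Phi> (of_real s) = of_real (\<phi> s)" if "\<bar>s\<bar> < R" for s
    using suminf_of_real[OF sum_real[OF that], where 'a = complex] by (simp add: \<Phi>_def \<phi>_def)
  have \<Phi>_le: "cmod (\<Phi> z) \<le> \<phi> (cmod z)" if "cmod z < R" for z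
  proof -
    have "cmod (\<Phi> z) \<le> (\<Sum>n. cmod (complex_of_real (b n) * z ^ n))"
      unfolding \<Phi>_def using sum_norm[of "cmod z"] that nonneg
      by (intro summable_norm) (simp add: norm_mult norm_power)
    then show ?thesis using nonneg by (simp add: \<phi>_def norm_mult norm_power)
  qed
  have \<phi>_mono: "\<phi> s < \<phi> s'" if s: "0 \<le> s" "s < s'" "s' < R" for s s'
  proof -
    have sm: "summable (\<lambda>n. b n * s' ^ n - b n * s ^ n)"
      using s by (intro summable_diff sum_real) auto
    have "0 < (\<Sum>n. b n * s' ^ n - b n * s ^ n)"
    proof (rule suminf_pos2[OF sm, where i = 1])
      show "0 \<le> b n * s' ^ n - b n * s ^ n" for n
        using s nonneg by (simp add: mult_left_mono power_mono)
    qed (use s b1 in simp)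
    then show ?thesis
      using suminf_diff[OF sum_real sum_real, of s' s] s by (simp add: \<phi>_def)
  qed
  have deriv: "(\<Phi> has_field_derivative (\<Sum>n. diffs (\<lambda>n. complex_of_real (b n)) n * z ^ n)) (at z)"
    if "cmod z < R" for z
    unfolding \<Phi>_def using that R by (intro termdiffs_strong[OF sum_R]) simp
  have deriv_real: "(\<phi> has_field_derivative (\<Sum>n. diffs b n * s ^ n)) (at s)" if "\<bar>s\<bar> < R" for s
    unfolding \<phi>_def using that R by (intro termdiffs_strong[OF summable]) simp
  have "\<exists>s. 0 \<le> s \<and> s \<le> t \<and> \<phi> s = y"
  proof (rule IVT)
    show "\<phi> 0 \<le> y" using y by (simp add: \<phi>_def)
    show "\<forall>s. 0 \<le> s \<and> s \<le> t \<longrightarrow> isCont \<phi> s"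
      using t by (intro allI impI DERIV_isCont[OF deriv_real]) auto
  qed (use y t in \<open>auto simp: \<phi>_def\<close>)
  then obtain s where s: "0 \<le> s" "s \<le> t" "\<phi> s = y" by blast
  have s0: "0 < s"
  proof (rule ccontr)
    assume "\<not> 0 < s"
    then have "s = 0" using s by simp
    then show False using s y by (simp add: \<phi>_def)
  qed
  have sR: "\<bar>s\<bar> < R" using s t by simp
  have y0: "0 \<le> y" using nonneg[of 0] y by simp
  \<comment> \<open>The modulus of \<Phi> at \<open>z\<close> is at most \<phi> at
    \<open>cmod z\<close>, which is below \<open>\<phi> s = y\<close>; \<open>y0\<close> identifies
    \<open>y\<close> with its modulus.\<close>
  have small: "\<Phi> z \<noteq> of_real y" if "cmod z < s" for z
    using \<Phi>_le[of z] \<phi>_mono[of "cmod z" s] that s sR y0 by auto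
  define D where "D = (\<Sum>n. diffs (\<lambda>n. complex_of_real (b n)) n * of_real s ^ n)"
  have D: "(\<Phi> has_field_derivative D) (at (of_real s))"
    unfolding D_def by (rule deriv) (use sR in simp)
  have "D \<noteq> 0"
  proof -
    have sm: "summable (\<lambda>n. diffs b n * s ^ n)"
      by (rule termdiff_converges[of s R]) (use sR R sum_real in auto)
    \<comment> \<open>The term of index 0 of the derivative is \<open>b 1\<close>.\<close>
    have "0 < (\<Sum>n. diffs b n * s ^ n)"
    proof (rule suminf_pos2[OF sm, where i = 0])
      show "0 \<le> diffs b n * s ^ n" for n
        using nonneg s by (simp add: diffs_def)
    qed (use b1 in \<open>simp add: diffs_def\<close>)
    moreover have "D = of_real (\<Sum>n. diffs b n * s ^ n)"
      using suminf_of_real[OF sm, where 'a = complex] by (simp add: D_def diffs_def)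
    ultimately show ?thesis by simp
  qed
  \<comment> \<open>The difference quotient tends to a nonzero limit, so it does not vanish near
    \<open>s\<close>.\<close>
  with D have "\<forall>\<^sub>F z in at (of_real s). (\<Phi> z - \<Phi> (of_real s)) / (z - of_real s) \<noteq> 0"
    by (intro tendsto_imp_eventually_ne[of _ D]) (auto simp: has_field_derivative_iff)
  then have "\<forall>\<^sub>F z in at (of_real s). \<Phi> z \<noteq> of_real y"
    by eventually_elim (use \<Phi>_real[OF sR] s in auto)
  with that[OF s0 s(2)] small \<Phi>_real[OF sR] s(3) show ?thesis
    by (auto simp: \<Phi>_def)
qed


section \<open>Positive rank-one perturbations\<close>

text \<open>Here \<open>q\<close> is a lower bound for the diagonal entry of \<open>K\<close> at
  \<open>a\<close>. For the lattice operator \<open>q = \<gamma> (p - 1)\<close> and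
  \<open>r = c + q\<close>, so \<open>gap\<close> becomes \<open>c < \<gamma>\<close>.\<close>

locale positive_rank_one = l2_op_bound K r
  for K :: "('a \<Rightarrow> complex) \<Rightarrow> ('a \<Rightarrow> complex)" and r :: real +
  fixes a :: 'a and \<gamma> c q :: real
  assumes pos: "\<And>f x. (\<And>x. f x \<in> \<real>\<^sub>\<ge>\<^sub>0) \<Longrightarrow> K f x \<in> \<real>\<^sub>\<ge>\<^sub>0"
    and diag: "\<And>f. (\<And>x. f x \<in> \<real>\<^sub>\<ge>\<^sub>0) \<Longrightarrow> q * Re (f a) \<le> Re (K f a)"
    and weight_pos: "0 < \<gamma>" and gap: "r < \<gamma> + q"
begin

definition T :: "('a \<Rightarrow> complex) \<Rightarrow> ('a \<Rightarrow> complex)" where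
  "T f x = K f x + of_real \<gamma> * (f a * l2_delta a x) - of_real c * f x"

text \<open>For \<open>r < cmod w\<close> this is the column at \<open>a\<close> of the resolvent of
  \<open>K\<close>.\<close>

abbreviation green :: "complex \<Rightarrow> 'a \<Rightarrow> complex" where
  "green w \<equiv> neumann K w (l2_delta a)"

lemma bounded_T: "bounded_l2_op T"
proof -
  have "bounded_l2_op (\<lambda>f x. K f x + of_real \<gamma> * (f a * l2_delta a x) + (- of_real c) * f x)"
    by (intro bounded_l2_op_add bounded bounded_l2_op_scale bounded_l2_op_eval l2_delta
        bounded_l2_op_mult[where C = "cmod (- of_real c)"]) simp
  then show ?thesis by (simp add: T_def[abs_def])
qed

text \<open>With \<open>P\<close> the projection onto the delta function at \<open>a\<close>,
  \<open>T - z = - (w - K - \<gamma> P)\<close>, and the Sherman-Morrison formula inverts the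
  rank-one perturbation of \<open>w - K\<close>. Its denominator is
  \<open>1 - \<gamma> (green w a)\<close>, which enters through \<open>k\<close>.\<close>

lemma resolventI:
  fixes z :: complex
  defines "w \<equiv> z + of_real c"
  assumes w: "r < cmod w" and g: "of_real \<gamma> * green w a \<noteq> 1"
  shows "z \<in> l2_resolvent_set T"
proof -
  let ?N = "neumann K w"
  define k where "k = of_real \<gamma> / (1 - of_real \<gamma> * green w a)"
  define R where "R f x = - ?N f x - k * (?N f a * green w x)" for f x
  have k: "k * (1 - of_real \<gamma> * green w a) = of_real \<gamma>"
    using g by (simp add: k_def)
  have u: "green w \<in> l2" by (rule neumann_l2(1)[OF w l2_delta(1)])
  have "bounded_l2_op (\<lambda>f x. (-1) * ?N f x + (- k) * (?N f a * green w x))"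
    by (intro bounded_l2_op_add bounded_l2_op_scale bounded_neumann[OF w]
        bounded_l2_op_comp[OF bounded_l2_op_eval[OF u] bounded_neumann[OF w]])
  then have "bounded_l2_op R" by (simp add: R_def[abs_def])
  moreover have "R (\<lambda>x. T f x - z * f x) = f" if f: "f \<in> l2" for f
  proof -
    have eq: "(\<lambda>x. T f x - z * f x) =
        (\<lambda>x. (-1) * (w * f x - K f x) + (of_real \<gamma> * f a) * l2_delta a x)"
      by (simp add: T_def w_def algebra_simps)
    have m: "(\<lambda>x. w * f x - K f x) \<in> l2"
      using l2_add(1)[OF l2_scale[OF f, of w] l2_scale[OF op_l2[OF f], of "-1"]] by simp
    have N: "?N (\<lambda>x. T f x - z * f x) = (\<lambda>x. (-1) * f x + (of_real \<gamma> * f a) * green w x)"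
      unfolding eq neumann_add[OF w l2_scale[OF m] l2_scale[OF l2_delta(1)]]
        neumann_scale[OF w m] neumann_scale[OF w l2_delta(1)] neumann_left[OF w f] ..
    have "R (\<lambda>x. T f x - z * f x) x = f x" for x
    proof -
      have "R (\<lambda>x. T f x - z * f x) x =
          f x + (k * (1 - of_real \<gamma> * green w a) - of_real \<gamma>) * f a * green w x"
        unfolding R_def N by (simp add: algebra_simps)
      then show ?thesis by (simp add: k)
    qed
    then show ?thesis by blast
  qed
  moreover have "(\<lambda>x. T (R f) x - z * R f x) = f" if f: "f \<in> l2" for f
  proof -
    have Nf: "?N f \<in> l2" by (rule neumann_l2(1)[OF w f])
    have R: "R f = (\<lambda>x. (-1) * ?N f x + (- k * ?N f a) * green w x)"
      by (simp add: R_def fun_eq_iff)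
    have K: "K (R f) = (\<lambda>x. (-1) * K (?N f) x + (- k * ?N f a) * K (green w) x)"
      unfolding R op_add[OF l2_scale[OF Nf] l2_scale[OF u]] op_scale[OF Nf] op_scale[OF u] ..
    have "T (R f) x - z * R f x = f x" for x
    proof -
      have "T (R f) x - z * R f x =
          (w * ?N f x - K (?N f) x) + k * ?N f a * (w * green w x - K (green w) x)
          + of_real \<gamma> * R f a * l2_delta a x"
        unfolding T_def K by (simp add: R_def w_def algebra_simps)
      also have "\<dots> = f x + (k * (1 - of_real \<gamma> * green w a) - of_real \<gamma>) * ?N f a * l2_delta a x"
        unfolding neumann_right[OF w f] neumann_right[OF w l2_delta(1)]
        by (simp add: R_def algebra_simps)
      finally show ?thesis by (simp add: k)
    qed
    then show ?thesis by blast
  qed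
  ultimately show ?thesis unfolding l2_resolvent_set_def by blast
qed

text \<open>The eigenvalue equation reads \<open>(w - K) f = \<gamma> (f a) \<delta>\<close>, so
  \<open>f\<close> is a multiple of \<open>green w\<close>. Conversely, the secular equation is the
  consistency of this relation at \<open>a\<close>.\<close>

lemma eigenspace:
  fixes z :: complex
  defines "w \<equiv> z + of_real c"
  assumes w: "r < cmod w" and g: "of_real \<gamma> * green w a = 1"
  shows "l2_eigenspace T z = {(\<lambda>x. k * green w x) | k. True}"
proof (intro equalityI subsetI)
  fix f assume "f \<in> l2_eigenspace T z"
  then have f: "f \<in> l2" and eig: "T f x = z * f x" for x
    by (auto simp: l2_eigenspace_def)
  have "w * f x - K f x = (of_real \<gamma> * f a) * l2_delta a x" for x
    using eig[of x] by (simp add: T_def w_def algebra_simps)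
  then have "f = (\<lambda>x. (of_real \<gamma> * f a) * green w x)"
    using neumann_left[OF w f] neumann_scale[OF w l2_delta(1)] by simp
  then show "f \<in> {(\<lambda>x. k * green w x) | k. True}" by blast
next
  fix f assume "f \<in> {(\<lambda>x. k * green w x) | k. True}"
  then obtain k where f: "f = (\<lambda>x. k * green w x)" by blast
  have u: "green w \<in> l2" by (rule neumann_l2(1)[OF w l2_delta(1)])
  have "T f x = z * f x" for x
  proof -
    have "T f x - z * f x =
        k * (of_real \<gamma> * green w a * l2_delta a x - (w * green w x - K (green w) x))"
      unfolding T_def f op_scale[OF u] by (simp add: w_def algebra_simps)
    then show ?thesis unfolding g neumann_right[OF w l2_delta(1)] by simp
  qed
  then show "f \<in> l2_eigenspace T z"
    using l2_scale[OF u] by (simp add: l2_eigenspace_def f fun_eq_iff)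
qed

section \<open>Positivity and power series of the Green function\<close>

lemma iter_delta_nonneg: "(K ^^ n) (l2_delta a) x \<in> \<real>\<^sub>\<ge>\<^sub>0"
proof (induction n arbitrary: x)
  case (Suc n)
  then show ?case using pos[of "(K ^^ n) (l2_delta a)"] by simp
qed (simp add: l2_delta_def)

text \<open>The partial sums lie in the closed cone of nonnegative reals, since \<open>w\<close> is
  positive and \<open>K\<close> preserves this cone.\<close>

lemma green_nonneg:
  assumes "r < w"
  shows "green (of_real w) x \<in> \<real>\<^sub>\<ge>\<^sub>0"
proof -
  have w: "0 \<le> w" "r < cmod (of_real w)" using assms r_nonneg by auto
  show ?thesis
  proof (rule Lim_in_closed_set[OF closed_nonneg_Reals_complex])
    show "(\<lambda>N. \<Sum>n<N. (K ^^ n) (l2_delta a) x / of_real w ^ Suc n) \<longlonglongrightarrow> green (of_real w) x"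
      using neumann_sums[OF w(2) l2_delta(1), of a x] by (simp add: sums_def)
    have "(\<Sum>n<N. (K ^^ n) (l2_delta a) x / of_real w ^ Suc n) \<in> \<real>\<^sub>\<ge>\<^sub>0" for N
    proof (induction N)
      case (Suc N)
      have "(K ^^ N) (l2_delta a) x / of_real w ^ Suc N \<in> \<real>\<^sub>\<ge>\<^sub>0"
        using w(1) by (intro nonneg_Reals_divide_I iter_delta_nonneg nonneg_Reals_pow_I) simp
      with Suc show ?case by (simp only: sum.lessThan_Suc nonneg_Reals_add_I)
    qed simp
    then show "\<forall>\<^sub>F N in sequentially. (\<Sum>n<N. (K ^^ n) (l2_delta a) x / of_real w ^ Suc n) \<in> \<real>\<^sub>\<ge>\<^sub>0"
      by simp
  qed simp
qed

text \<open>In the variable \<open>1 / w\<close> the secular equation \<open>\<gamma> (green w a) = 1\<close> reads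
  \<open>(\<Sum>n. green_coeff n / w ^ n) = 1 / \<gamma>\<close>.\<close>

definition green_coeff :: "nat \<Rightarrow> real" where
  "green_coeff n = (case n of 0 \<Rightarrow> 0 | Suc m \<Rightarrow> Re ((K ^^ m) (l2_delta a) a))"

lemma of_real_green_coeff: "complex_of_real (green_coeff (Suc n)) = (K ^^ n) (l2_delta a) a"
  using iter_delta_nonneg[of n a] by (auto simp: green_coeff_def elim: nonneg_Reals_cases)

lemma green_coeff_nonneg: "0 \<le> green_coeff n"
  using iter_delta_nonneg by (auto simp: green_coeff_def complex_nonneg_Reals_iff split: nat.split)

lemma green_coeff_le: "green_coeff (Suc n) \<le> r ^ n"
proof -
  have "green_coeff (Suc n) \<le> cmod ((K ^^ n) (l2_delta a) a)"
    by (simp add: green_coeff_def complex_Re_le_cmod)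
  also have "\<dots> \<le> l2_norm ((K ^^ n) (l2_delta a))"
    by (intro cmod_le_l2_norm iter_l2 l2_delta)
  also have "\<dots> \<le> r ^ n * l2_norm (l2_delta a)" by (intro iter_norm l2_delta)
  also have "\<dots> \<le> r ^ n * 1" using r_nonneg by (intro mult_left_mono l2_delta) simp
  finally show ?thesis by simp
qed

lemma summable_green_coeff:
  assumes "0 \<le> t" "r * t < 1"
  shows "summable (\<lambda>n. green_coeff n * t ^ n)"
proof -
  have "summable (\<lambda>n. green_coeff (Suc n) * t ^ Suc n)"
  proof (rule summable_comparison_test')
    show "summable (\<lambda>n. t * (r * t) ^ n)"
      using assms r_nonneg by (intro summable_mult summable_geometric) simp
    show "norm (green_coeff (Suc n) * t ^ Suc n) \<le> t * (r * t) ^ n" for n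
    proof -
      have "green_coeff (Suc n) * t ^ Suc n \<le> r ^ n * t ^ Suc n"
        using assms by (intro mult_right_mono green_coeff_le) simp
      then show ?thesis
        using assms by (simp add: abs_mult green_coeff_nonneg power_mult_distrib mult_ac)
    qed
  qed
  then show ?thesis by (subst (asm) summable_Suc_iff)
qed

lemma green_power_series:
  assumes "r < cmod w"
  shows "green w a = (\<Sum>n. of_real (green_coeff n) * (1 / w) ^ n)"
proof -
  have "(\<lambda>n. of_real (green_coeff (Suc n)) * (1 / w) ^ Suc n) sums green w a"
    using neumann_sums[OF assms l2_delta(1), of a a]
    by (simp add: of_real_green_coeff power_one_over field_simps)
  then have "(\<lambda>n. of_real (green_coeff n) * (1 / w) ^ n) sums green w a"
    using sums_Suc[of "\<lambda>n. of_real (green_coeff n) * (1 / w) ^ n" "green w a"]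
    by (simp add: green_coeff_def)
  then show ?thesis by (rule sums_unique)
qed

text \<open>Write \<open>G\<close> for the Green function at \<open>w = \<gamma> + q\<close>. Then
  \<open>(w - K) G = \<delta>\<close> at \<open>a\<close> gives
  \<open>1 = (\<gamma> + q) G a - K G a\<close>, and \<open>K G a \<ge> q (G a)\<close> leaves
  \<open>1 \<le> \<gamma> (G a)\<close>.\<close>

lemma green_lower: "1 / \<gamma> \<le> Re (green (of_real (\<gamma> + q)) a)"
proof -
  let ?w = "complex_of_real (\<gamma> + q)"
  have w: "r < cmod ?w" using gap r_nonneg by (simp del: of_real_add)
  have "?w * green ?w a - K (green ?w) a = 1"
    using neumann_right[OF w l2_delta(1), of a a] by (simp add: l2_delta_def del: of_real_add)
  then have "(\<gamma> + q) * Re (green ?w a) - Re (K (green ?w) a) = 1"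
    by (metis Re_complex_of_real minus_complex.sel(1) one_complex.sel(1) scaleR_conv_of_real scaleR_complex.sel(1))
  moreover have "q * Re (green ?w a) \<le> Re (K (green ?w) a)"
    by (rule diag[OF green_nonneg[OF gap]])
  ultimately show ?thesis using weight_pos by (simp add: field_simps del: of_real_add)
qed

text \<open>The substitution \<open>1 / w\<close> turns the root of smallest modulus from
  \<open>nonneg_power_series_root\<close> into the dominant root \<open>W = 1 / s\<close> of the
  secular equation.\<close>

theorem top_of_spectrum:
  obtains W where "\<gamma> + q \<le> W" "of_real \<gamma> * green (of_real W) a = 1"
    and "\<And>z. z \<in> l2_spectrum T \<Longrightarrow> Re z \<le> W - c"
    and "\<forall>\<^sub>F z in at (of_real (W - c)). z \<notin> l2_spectrum T"
proof -
  define v where "v = \<gamma> + q"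
  \<comment> \<open>The reciprocal of the midpoint between \<open>r\<close> and \<open>v\<close>:
    the series still converges at \<open>R\<close>, and \<open>R\<close> exceeds
    \<open>1 / v\<close>.\<close>
  define R where "R = 2 / (v + r)"
  define h where "h z = (\<Sum>n. complex_of_real (green_coeff n) * z ^ n)" for z
  have v: "r < v" "0 < v" using gap r_nonneg by (auto simp: v_def)
  have R: "0 < R" "r * R < 1" "1 / v < R"
    using v r_nonneg by (auto simp: R_def field_simps)
  have sv: "summable (\<lambda>n. green_coeff n * (1 / v) ^ n)"
    using v by (intro summable_green_coeff) (auto simp: field_simps)
  have "green (of_real v) a = (\<Sum>n. of_real (green_coeff n * (1 / v) ^ n))"
    using v r_nonneg by (subst green_power_series) simp_all
  also have "\<dots> = of_real (\<Sum>n. green_coeff n * (1 / v) ^ n)"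
    by (rule suminf_of_real[OF sv, symmetric])
  finally have low: "1 / \<gamma> \<le> (\<Sum>n. green_coeff n * (1 / v) ^ n)"
    using green_lower by (simp add: v_def del: of_real_add)
  have b1: "0 < green_coeff 1" by (simp add: green_coeff_def l2_delta_def)
  have b0: "green_coeff 0 < 1 / \<gamma>" using weight_pos by (simp add: green_coeff_def)
  have tv: "0 < 1 / v" using v by simp
  obtain s where s: "0 < s" "s \<le> 1 / v" "h (of_real s) = of_real (1 / \<gamma>)"
    and small: "\<And>z. cmod z < s \<Longrightarrow> h z \<noteq> of_real (1 / \<gamma>)"
    and near: "\<forall>\<^sub>F z in at (of_real s). h z \<noteq> of_real (1 / \<gamma>)"
    unfolding h_def
    using nonneg_power_series_root[OF green_coeff_nonneg b1
        summable_green_coeff[OF less_imp_le[OF R(1)] R(2)] tv R(3) b0 low] by blast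
  define W where "W = 1 / s"
  have W: "v \<le> W" using s v by (simp add: W_def field_simps)
  then have Wr: "r < W" "0 < W" using v by auto
  have secular: "of_real \<gamma> * green w a = 1 \<longleftrightarrow> h (1 / w) = of_real (1 / \<gamma>)" if "r < cmod w" for w
    using green_power_series[OF that] weight_pos by (simp add: h_def field_simps)
  have res: "z \<notin> l2_spectrum T"
    if "r < cmod (z + of_real c)" "h (1 / (z + of_real c)) \<noteq> of_real (1 / \<gamma>)" for z
    using resolventI[of z] secular[OF that(1)] that by (simp add: l2_spectrum_def)
  show ?thesis
  proof (rule that)
    show "\<gamma> + q \<le> W" using W by (simp add: v_def)
    show "of_real \<gamma> * green (of_real W) a = 1"
      using secular[of "of_real W"] Wr s by (simp add: W_def norm_divide)
    show "Re z \<le> W - c" if "z \<in> l2_spectrum T" for z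
    proof (rule ccontr)
      assume "\<not> Re z \<le> W - c"
      \<comment> \<open>Such a \<open>z\<close> has \<open>cmod (z + c) > W > r\<close>, so
        \<open>1 / (z + c)\<close> lies in the disc of radius \<open>s\<close>, where the secular
        equation has no root.\<close>
      then have *: "W < cmod (z + of_real c)"
        using complex_Re_le_cmod[of "z + of_real c"] by simp
      then have "1 / cmod (z + of_real c) < 1 / W"
        using Wr by (intro divide_strict_left_mono mult_pos_pos) linarith+
      then have "cmod (1 / (z + of_real c)) < s"
        by (simp add: norm_divide W_def)
      then show False using res[of z] small * Wr that by force
    qed
    \<comment> \<open>The map is continuous at \<open>W - c\<close> and takes the value
      \<open>s\<close> only there, so it carries punctured neighbourhoods into punctured
      neighbourhoods and transports \<open>near\<close>.\<close>
    have "filterlim (\<lambda>z. 1 / (z + of_real c)) (at (of_real s)) (at (complex_of_real (W - c)))"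
    proof (rule filterlim_atI)
      have "((\<lambda>z. 1 / (z + of_real c)) \<longlongrightarrow> 1 / (of_real (W - c) + of_real c))
          (at (complex_of_real (W - c)))"
        using Wr by (intro tendsto_intros) simp
      then show "((\<lambda>z. 1 / (z + of_real c)) \<longlongrightarrow> of_real s) (at (complex_of_real (W - c)))"
        by (simp add: W_def)
      have "\<forall>\<^sub>F z in at (complex_of_real (W - c)). z \<noteq> of_real (W - c)"
        by (rule eventually_neq_at_within)
      then show "\<forall>\<^sub>F z in at (complex_of_real (W - c)). 1 / (z + of_real c) \<noteq> of_real s"
      proof eventually_elim
        case (elim z)
        show ?case
        proof
          assume "1 / (z + of_real c) = of_real s"
          then have "z + of_real c = of_real W"
            by (simp add: W_def) (metis div_by_1 divide_divide_eq_right mult_1)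
          then show False using elim by (simp add: algebra_simps)
        qed
      qed
    qed
    with near have "\<forall>\<^sub>F z in at (of_real (W - c)). h (1 / (z + of_real c)) \<noteq> of_real (1 / \<gamma>)"
      by (rule eventually_compose_filterlim)
    moreover have "\<forall>\<^sub>F z in at (complex_of_real (W - c)). r < cmod (z + of_real c)"
    proof (rule order_tendstoD(1))
      show "((\<lambda>z. cmod (z + of_real c)) \<longlongrightarrow> cmod (of_real (W - c) + of_real c)) (at (of_real (W - c)))"
        by (intro tendsto_intros)
    qed (use Wr in simp)
    ultimately show "\<forall>\<^sub>F z in at (of_real (W - c)). z \<notin> l2_spectrum T"
      by eventually_elim (rule res)
  qed
qed

end


section \<open>The lattice operator\<close>

lemma sum_eq_1E:
  fixes h :: "'n::finite \<Rightarrow> int"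
  assumes "(\<Sum>j\<in>UNIV. h j) = 1" and nonneg: "\<And>j. 0 \<le> h j"
  obtains j where "h j = 1" "\<And>k. k \<noteq> j \<Longrightarrow> h k = 0"
proof -
  obtain j where j: "h j \<noteq> 0"
    using assms(1) by (metis sum.neutral zero_neq_one)
  have split: "h j + (\<Sum>k\<in>UNIV - {j}. h k) = 1"
    using assms(1) by (simp add: sum.remove[of UNIV j])
  moreover have "0 \<le> (\<Sum>k\<in>UNIV - {j}. h k)" by (intro sum_nonneg nonneg)
  moreover have "1 \<le> h j" using j nonneg[of j] by simp
  ultimately have "h j = 1" "(\<Sum>k\<in>UNIV - {j}. h k) = 0" by linarith+
  then show ?thesis
    using that[of j] nonneg by (simp add: sum_nonneg_eq_0_iff)
qed

text \<open>Every unit vector is plus or minus a coordinate vector. The count enters only through an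
  upper bound on the jump rate \<open>c\<close>.\<close>

lemma card_unit_steps_le: "card (unit_steps :: (int ^ 'd::finite) set) \<le> 2 * CARD('d)"
proof -
  have "(unit_steps :: (int ^ 'd) set) \<subseteq> (\<lambda>(j, s). axis j s) ` (UNIV \<times> {-1, 1})"
  proof
    fix e :: "int ^ 'd" assume "e \<in> unit_steps"
    then obtain j where j: "\<bar>e $ j\<bar> = 1" "\<And>k. k \<noteq> j \<Longrightarrow> \<bar>e $ k\<bar> = 0"
      unfolding unit_steps_def by (auto elim: sum_eq_1E)
    have "e = axis j (e $ j)" using j(2) by (auto simp: vec_eq_iff axis_def)
    moreover have "e $ j \<in> {-1, 1}" using j(1) by auto
    ultimately show "e \<in> (\<lambda>(j, s). axis j s) ` (UNIV \<times> {-1, 1})" by force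
  qed
  then have "card (unit_steps :: (int ^ 'd) set) \<le> card (UNIV \<times> {-1, 1 :: int} :: ('d \<times> int) set)"
    by (intro surj_card_le) auto
  then show ?thesis by (simp add: card_cartesian_product)
qed

lemma card_unit_steps_tuple_le:
  "card (unit_steps_tuple :: (int ^ 'd::finite ^ 'p::finite) set) \<le> 2 * CARD('d) * CARD('p)"
proof -
  let ?E = "UNIV \<times> unit_steps :: ('p \<times> (int ^ 'd)) set"
  have "(unit_steps_tuple :: (int ^ 'd ^ 'p) set) \<subseteq> (\<lambda>(i, u). axis i u) ` ?E"
  proof
    fix e :: "int ^ 'd ^ 'p" assume "e \<in> unit_steps_tuple"
    then have "(\<Sum>i\<in>UNIV. \<Sum>j\<in>UNIV. \<bar>e $ i $ j\<bar>) = 1"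
      by (simp add: unit_steps_tuple_def)
    then obtain i where i: "(\<Sum>j\<in>UNIV. \<bar>e $ i $ j\<bar>) = 1"
        "\<And>k. k \<noteq> i \<Longrightarrow> (\<Sum>j\<in>UNIV. \<bar>e $ k $ j\<bar>) = 0"
      by (rule sum_eq_1E) (auto intro: sum_nonneg)
    have "e $ k = 0" if "k \<noteq> i" for k
      using i(2)[OF that] by (simp add: sum_nonneg_eq_0_iff vec_eq_iff)
    then have "e = axis i (e $ i)" by (auto simp: vec_eq_iff axis_def)
    moreover have "e $ i \<in> unit_steps" using i(1) by (simp add: unit_steps_def)
    ultimately show "e \<in> (\<lambda>(i, u). axis i u) ` ?E" by force
  qed
  then have "card (unit_steps_tuple :: (int ^ 'd ^ 'p) set) \<le> card ?E"
    by (intro surj_card_le) (auto simp: finite_unit_steps)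
  also have "\<dots> \<le> CARD('p) * (2 * CARD('d))"
    by (simp add: card_cartesian_product card_unit_steps_le)
  finally show ?thesis by (simp add: mult_ac)
qed

lemma uminus_unit_steps_tuple: "e \<in> unit_steps_tuple \<Longrightarrow> - e \<in> unit_steps_tuple"
  by (simp add: unit_steps_tuple_def)

text \<open>Connectedness of the lattice, by induction on the 1-norm.\<close>

lemma lattice_induct [case_names zero step]:
  fixes x :: "int ^ 'd::finite ^ 'p::finite"
  assumes zero: "P 0" and step: "\<And>x e. P x \<Longrightarrow> e \<in> unit_steps_tuple \<Longrightarrow> P (x + e)"
  shows "P x"
proof (induction x rule: measure_induct_rule[of "\<lambda>x. nat (\<Sum>i\<in>UNIV. \<Sum>j\<in>UNIV. \<bar>x $ i $ j\<bar>)"])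
  case (less x)
  show ?case
  proof (cases "x = 0")
    case False
    then obtain i j where ij: "x $ i $ j \<noteq> 0" by (auto simp: vec_eq_iff)
    \<comment> \<open>Subtracting the sign of a nonzero coordinate moves one step towards the
      origin.\<close>
    define e :: "int ^ 'd ^ 'p" where "e = axis i (axis j (sgn (x $ i $ j)))"
    have e_nth: "e $ k $ l = (if k = i \<and> l = j then sgn (x $ i $ j) else 0)" for k l
      by (auto simp: e_def axis_def)
    have "(\<Sum>k\<in>UNIV. \<Sum>l\<in>UNIV. \<bar>e $ k $ l\<bar>) = (\<Sum>k\<in>UNIV. \<Sum>l\<in>UNIV. if k = i \<and> l = j then 1 else 0)"
      using ij by (intro sum.cong) (auto simp: e_nth)
    also have "\<dots> = (\<Sum>k\<in>UNIV. if k = i then 1 else 0)"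
      by (intro sum.cong) auto
    finally have e: "e \<in> unit_steps_tuple" by (simp add: unit_steps_tuple_def)
    have le: "\<bar>(x - e) $ k $ l\<bar> \<le> \<bar>x $ k $ l\<bar>" for k l
      by (auto simp: e_nth sgn_if)
    have lt: "\<bar>(x - e) $ i $ j\<bar> < \<bar>x $ i $ j\<bar>"
      using ij by (auto simp: e_nth sgn_if)
    have "(\<Sum>k\<in>UNIV. \<Sum>l\<in>UNIV. \<bar>(x - e) $ k $ l\<bar>) < (\<Sum>k\<in>UNIV. \<Sum>l\<in>UNIV. \<bar>x $ k $ l\<bar>)"
    proof (rule sum_strict_mono_ex1)
      have "(\<Sum>l\<in>UNIV. \<bar>(x - e) $ i $ l\<bar>) < (\<Sum>l\<in>UNIV. \<bar>x $ i $ l\<bar>)"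
        using le lt by (intro sum_strict_mono_ex1) auto
      then show "\<exists>k\<in>UNIV. (\<Sum>l\<in>UNIV. \<bar>(x - e) $ k $ l\<bar>) < (\<Sum>l\<in>UNIV. \<bar>x $ k $ l\<bar>)" by blast
    qed (use le in \<open>auto intro: sum_mono\<close>)
    moreover have "0 \<le> (\<Sum>k\<in>UNIV. \<Sum>l\<in>UNIV. \<bar>(x - e) $ k $ l\<bar>)"
      by (intro sum_nonneg) simp
    ultimately have "P (x - e)" by (intro less) linarith
    from step[OF this e] show ?thesis by simp
  qed (simp add: zero)
qed

section \<open>Splitting the Hamiltonian into a positive part and a rank-one term\<close>

text \<open>What remains of the potential after one unit at the origin is moved into the rank-one
  term.\<close>

definition excess :: "int ^ 'd::finite ^ 'p::finite \<Rightarrow> real" where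
  "excess x = (\<Sum>i\<in>UNIV. of_bool (x $ i = 0)) - of_bool (x = 0)"

lemma excess_0: "excess (0 :: int ^ 'd::finite ^ 'p::finite) = real CARD('p) - 1"
  by (simp add: excess_def)

lemma excess_nonneg: "0 \<le> excess x"
  by (cases "x = 0") (auto simp: excess_def intro: sum_nonneg)

text \<open>Away from the origin some component of \<open>x\<close> is nonzero and drops out of the
  sum; at the origin the subtraction removes one.\<close>

lemma excess_le: "excess (x :: int ^ 'd::finite ^ 'p::finite) \<le> real CARD('p) - 1"
proof (cases "x = 0")
  case False
  then obtain i where i: "x $ i \<noteq> 0" by (auto simp: vec_eq_iff)
  have "excess x = (\<Sum>k\<in>UNIV - {i}. of_bool (x $ k = 0))"
    unfolding excess_def by (subst sum.remove[of UNIV i]) (use False i in simp_all)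
  also have "\<dots> \<le> (\<Sum>k\<in>UNIV - {i}. 1)" by (intro sum_mono) simp
  also have "\<dots> = real CARD('p) - 1" by (simp add: of_nat_diff)
  finally show ?thesis .
qed (simp add: excess_0)

text \<open>The operator \<open>K\<close> of the splitting: jumps without their diagonal loss, plus
  the remaining potential.\<close>

definition positive_part ::
    "real \<Rightarrow> real \<Rightarrow> real \<Rightarrow>
     (int ^ 'd::finite ^ 'p::finite \<Rightarrow> complex) \<Rightarrow> (int ^ 'd ^ 'p \<Rightarrow> complex)" where
  "positive_part \<kappa> \<rho> \<gamma> f x =
     of_real \<kappa> * (\<Sum>e\<in>unit_steps_tuple. f (x + e)) +
     of_real \<rho> * (\<Sum>e\<in>unit_steps. f (x + vec e)) +
     of_real (\<gamma> * excess x) * f x"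

text \<open>Translations preserve the norm, so each jump contributes its rate, and multiplication by
  the remaining potential contributes at most \<open>\<gamma> (p - 1)\<close>.\<close>

lemma positive_part_bound:
  assumes "0 \<le> \<kappa>" "0 \<le> \<rho>" "0 \<le> \<gamma>"
  shows "l2_op_bound (positive_part \<kappa> \<rho> \<gamma> ::
      (int ^ 'd::finite ^ 'p::finite \<Rightarrow> complex) \<Rightarrow> (int ^ 'd ^ 'p \<Rightarrow> complex))
    (\<kappa> * card (unit_steps_tuple :: (int ^ 'd ^ 'p) set)
      + \<rho> * card (unit_steps :: (int ^ 'd) set) + \<gamma> * (real CARD('p) - 1))"
proof
  let ?K = "positive_part \<kappa> \<rho> \<gamma> :: (int ^ 'd ^ 'p \<Rightarrow> complex) \<Rightarrow> (int ^ 'd ^ 'p \<Rightarrow> complex)"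
  let ?E = "unit_steps_tuple :: (int ^ 'd ^ 'p) set"
  let ?E' = "unit_steps :: (int ^ 'd) set"
  have p: "0 \<le> real CARD('p) - 1" by (simp add: Suc_leI)
  have m: "cmod (of_real (\<gamma> * excess x)) \<le> \<gamma> * (real CARD('p) - 1)" for x :: "int ^ 'd ^ 'p"
    using assms excess_nonneg[of x] excess_le[of x] by (simp add: norm_mult mult_left_mono)
  show "bounded_l2_op ?K"
    unfolding positive_part_def[abs_def]
    by (intro bounded_l2_op_add bounded_l2_op_scale bounded_l2_op_sum bounded_l2_op_translate
        finite_unit_steps finite_unit_steps_tuple bounded_l2_op_mult[OF m])
  show "0 \<le> \<kappa> * card ?E + \<rho> * card ?E' + \<gamma> * (real CARD('p) - 1)"
    using assms p by simp
  fix f :: "int ^ 'd ^ 'p \<Rightarrow> complex" assume f: "f \<in> l2"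
  have tr: "(\<lambda>x. f (x + e)) \<in> l2" for e
    using bounded_l2_op_translate[of e] f unfolding bounded_l2_op_def by blast
  define A where "A x = (\<Sum>e\<in>?E. f (x + e))" for x
  define B where "B x = (\<Sum>e\<in>?E'. f (x + vec e))" for x
  have A: "A \<in> l2" "l2_norm A \<le> card ?E * l2_norm f"
    using l2_sum[of ?E "\<lambda>e x. f (x + e)"] tr by (simp_all add: A_def[abs_def] l2_norm_translate)
  have B: "B \<in> l2" "l2_norm B \<le> card ?E' * l2_norm f"
    using l2_sum[of ?E' "\<lambda>e x. f (x + vec e)"] tr by (simp_all add: B_def[abs_def] l2_norm_translate)
  have M: "(\<lambda>x. of_real (\<gamma> * excess x) * f x) \<in> l2"
    using bounded_l2_op_mult[of "\<lambda>x. of_real (\<gamma> * excess x)", OF m] f unfolding bounded_l2_op_def by blast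
  have AB: "(\<lambda>x. of_real \<kappa> * A x + of_real \<rho> * B x) \<in> l2"
    by (intro l2_add l2_scale A B)
  have "l2_norm (?K f) = l2_norm (\<lambda>x. (of_real \<kappa> * A x + of_real \<rho> * B x) + of_real (\<gamma> * excess x) * f x)"
    by (simp add: positive_part_def[abs_def] A_def B_def)
  also have "\<dots> \<le> l2_norm (\<lambda>x. of_real \<kappa> * A x + of_real \<rho> * B x) +
      l2_norm (\<lambda>x. of_real (\<gamma> * excess x) * f x)"
    by (rule l2_norm_triangle[OF AB M])
  also have "\<dots> \<le> (l2_norm (\<lambda>x. of_real \<kappa> * A x) + l2_norm (\<lambda>x. of_real \<rho> * B x)) +
      \<gamma> * (real CARD('p) - 1) * l2_norm f"
    by (intro add_mono l2_norm_triangle l2_norm_mult_le m f l2_scale A B)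
  also have "\<dots> \<le> (\<kappa> * (card ?E * l2_norm f) + \<rho> * (card ?E' * l2_norm f)) +
      \<gamma> * (real CARD('p) - 1) * l2_norm f"
    using assms A(2) B(2) by (intro add_mono) (simp_all add: l2_norm_scale mult_left_mono)
  finally show "l2_norm (?K f) \<le>
      (\<kappa> * card ?E + \<rho> * card ?E' + \<gamma> * (real CARD('p) - 1)) * l2_norm f"
    by (simp add: algebra_simps)
qed

text \<open>The terms \<open>- f x\<close> of the jumps add up to the constant shift, and the unit
  removed in \<open>excess\<close> returns as the rank-one term.\<close>

lemma hamiltonian_eq:
  fixes f :: "int ^ 'd::finite ^ 'p::finite \<Rightarrow> complex"
  shows "hamiltonian \<kappa> \<rho> \<gamma> f x =
    positive_part \<kappa> \<rho> \<gamma> f x + of_real \<gamma> * (f 0 * l2_delta 0 x) -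
    of_real (\<kappa> * card (unit_steps_tuple :: (int ^ 'd ^ 'p) set)
      + \<rho> * card (unit_steps :: (int ^ 'd) set)) * f x"
proof -
  have "potential f x = of_real (excess x + of_bool (x = 0)) * f x"
    by (simp add: potential_def excess_def sum_distrib_right)
  also have "\<dots> = of_real (excess x) * f x + f 0 * l2_delta 0 x"
    by (auto simp: l2_delta_def algebra_simps)
  finally show ?thesis
    by (simp add: hamiltonian_def hopping_def positive_part_def sum_subtractf algebra_simps)
qed

lemma positive_part_nonneg:
  fixes f :: "int ^ 'd::finite ^ 'p::finite \<Rightarrow> complex"
  assumes "0 \<le> \<kappa>" "0 \<le> \<rho>" "0 \<le> \<gamma>" and f: "\<And>x. f x \<in> \<real>\<^sub>\<ge>\<^sub>0"
  shows "positive_part \<kappa> \<rho> \<gamma> f x \<in> \<real>\<^sub>\<ge>\<^sub>0"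
proof -
  have sum: "(\<Sum>e\<in>E. f (h e)) \<in> \<real>\<^sub>\<ge>\<^sub>0" for E and h :: "'b \<Rightarrow> _"
    by (induction E rule: infinite_finite_induct) (auto intro: nonneg_Reals_add_I f)
  show ?thesis
    unfolding positive_part_def using assms excess_nonneg[of x]
    by (intro nonneg_Reals_add_I nonneg_Reals_mult_I sum f) simp_all
qed

text \<open>A sum of nonnegative terms dominates each of them. The first part gives
  \<open>diag\<close> at the origin, the second propagates strict positivity to neighbours.\<close>

lemma Re_positive_part_ge:
  fixes f :: "int ^ 'd::finite ^ 'p::finite \<Rightarrow> complex"
  assumes "0 \<le> \<kappa>" "0 \<le> \<rho>" "0 \<le> \<gamma>" and f: "\<And>x. f x \<in> \<real>\<^sub>\<ge>\<^sub>0"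
  shows "\<gamma> * excess x * Re (f x) \<le> Re (positive_part \<kappa> \<rho> \<gamma> f x)"
    and "e \<in> unit_steps_tuple \<Longrightarrow> \<kappa> * Re (f (x + e)) \<le> Re (positive_part \<kappa> \<rho> \<gamma> f x)"
proof -
  let ?A = "\<Sum>e\<in>unit_steps_tuple. Re (f (x + e))" and ?B = "\<Sum>e\<in>unit_steps. Re (f (x + vec e))"
  have Re_f: "0 \<le> Re (f y)" for y
    using f[of y] by (simp add: complex_nonneg_Reals_iff)
  have eq: "Re (positive_part \<kappa> \<rho> \<gamma> f x) = \<kappa> * ?A + \<rho> * ?B + \<gamma> * excess x * Re (f x)"
    by (simp add: positive_part_def)
  have A: "0 \<le> \<kappa> * ?A" and B: "0 \<le> \<rho> * ?B" and C: "0 \<le> \<gamma> * excess x * Re (f x)"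
    using assms Re_f excess_nonneg[of x] by (auto intro!: mult_nonneg_nonneg sum_nonneg)
  show "\<gamma> * excess x * Re (f x) \<le> Re (positive_part \<kappa> \<rho> \<gamma> f x)"
    using A B eq by linarith
  assume "e \<in> unit_steps_tuple"
  then have "\<kappa> * Re (f (x + e)) \<le> \<kappa> * ?A"
    using assms Re_f
    by (intro mult_left_mono member_le_sum[of e _ "\<lambda>e. Re (f (x + e))"] finite_unit_steps_tuple) auto
  then show "\<kappa> * Re (f (x + e)) \<le> Re (positive_part \<kappa> \<rho> \<gamma> f x)"
    using B C eq by linarith
qed

section \<open>Application to the Hamiltonian\<close>

theorem theorem7:
  fixes \<kappa> \<rho> \<gamma> lam :: real
    and H :: "(int ^ 'd::finite ^ 'p::finite \<Rightarrow> complex) \<Rightarrow> (int ^ 'd ^ 'p \<Rightarrow> complex)"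
  assumes "\<kappa> > 0" and "\<rho> > 0"
    and "\<gamma> > 4 * real CARD('d) * (\<kappa> * real CARD('p) + \<rho>)"
    and "H = hamiltonian \<kappa> \<rho> \<gamma>"
    and "lam = Sup (Re ` l2_spectrum H)"
  shows "lam > 0 \<and>
    complex_of_real lam isolated_in l2_spectrum H \<and>
    complex_of_real lam \<in> l2_point_spectrum H \<and>
    one_dimensional (l2_eigenspace H (complex_of_real lam)) \<and>
    (\<exists>u :: int ^ 'd ^ 'p \<Rightarrow> real.
       (\<lambda>x. complex_of_real (u x)) \<in> l2_eigenspace H (complex_of_real lam) \<and> (\<forall>x. u x > 0))"
proof -
  define c where "c = \<kappa> * card (unit_steps_tuple :: (int ^ 'd ^ 'p) set)
      + \<rho> * card (unit_steps :: (int ^ 'd) set)"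
  define q where "q = \<gamma> * (real CARD('p) - 1)"
  let ?K = "positive_part \<kappa> \<rho> \<gamma> :: (int ^ 'd ^ 'p \<Rightarrow> complex) \<Rightarrow> (int ^ 'd ^ 'p \<Rightarrow> complex)"
  have "\<kappa> * card (unit_steps_tuple :: (int ^ 'd ^ 'p) set) \<le> \<kappa> * real (2 * CARD('d) * CARD('p))"
    using assms(1) by (intro mult_left_mono of_nat_mono card_unit_steps_tuple_le) simp
  moreover have "\<rho> * card (unit_steps :: (int ^ 'd) set) \<le> \<rho> * real (2 * CARD('d))"
    using assms(2) by (intro mult_left_mono of_nat_mono card_unit_steps_le) simp
  \<comment> \<open>This bound is below \<gamma>, which yields the gap condition
    \<open>c + q < \<gamma> + q\<close>.\<close>
  ultimately have "c \<le> 2 * real CARD('d) * (\<kappa> * real CARD('p) + \<rho>)"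
    by (simp add: c_def algebra_simps)
  moreover have c0: "0 \<le> c" using assms by (simp add: c_def)
  moreover have "0 < 2 * real CARD('d) * (\<kappa> * real CARD('p) + \<rho>)"
    using assms by (intro mult_pos_pos add_pos_pos) auto
  ultimately have \<gamma>: "0 < \<gamma>" "c < \<gamma>" using assms(3) by linarith+
  have q0: "0 \<le> q" using \<gamma> by (simp add: q_def Suc_leI)
  interpret l2_op_bound ?K "c + q"
    using positive_part_bound[of \<kappa> \<rho> \<gamma>, where 'd = 'd and 'p = 'p] assms \<gamma>
    by (simp add: c_def q_def)
  interpret positive_rank_one ?K "c + q" 0 \<gamma> c q
  proof
    show "?K f x \<in> \<real>\<^sub>\<ge>\<^sub>0" if "\<And>x. f x \<in> \<real>\<^sub>\<ge>\<^sub>0" for f x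
      by (rule positive_part_nonneg) (use that assms \<gamma> in auto)
    show "q * Re (f 0) \<le> Re (?K f 0)" if "\<And>x. f x \<in> \<real>\<^sub>\<ge>\<^sub>0" for f
      using Re_positive_part_ge(1)[OF _ _ _ that, of \<kappa> \<rho> \<gamma> 0] assms \<gamma> by (simp add: q_def excess_0)
  qed (use \<gamma> in auto)
  have H: "H = T"
    unfolding assms(4) by (intro ext, subst T_def, simp only: hamiltonian_eq c_def)
  obtain W where W: "\<gamma> + q \<le> W" and secular: "of_real \<gamma> * green (of_real W) 0 = 1"
    and top: "\<And>z. z \<in> l2_spectrum T \<Longrightarrow> Re z \<le> W - c"
    and isolated: "\<forall>\<^sub>F z in at (of_real (W - c)). z \<notin> l2_spectrum T"
    by (rule top_of_spectrum) blast
  have Wr: "c + q < W" "0 < W" using W \<gamma> c0 q0 by linarith+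
  then have w: "c + q < cmod (of_real W)" by simp
  let ?u = "green (of_real W)"
  have E: "l2_eigenspace T (of_real (W - c)) = {(\<lambda>x. k * ?u x) | k. True}"
    using eigenspace[of "of_real (W - c)"] w secular by simp
  have nonneg: "?u x \<in> \<real>\<^sub>\<ge>\<^sub>0" for x by (rule green_nonneg[OF Wr(1)])
  then have real: "?u x = of_real (Re (?u x))" and Re0: "0 \<le> Re (?u x)" for x
    by (auto simp: complex_nonneg_Reals_iff complex_eq_iff)
  have u0: "0 < Re (?u 0)"
  proof -
    have "?u 0 \<noteq> 0" using secular by auto
    then show ?thesis using real[of 0] Re0[of 0] by (metis of_real_0 less_eq_real_def)
  qed
  have pos_u: "0 < Re (?u x)" for x
  proof (induction x rule: lattice_induct)
    case (step x e)
    \<comment> \<open>In \<open>W u = K u + \<delta>\<close> at \<open>x + e\<close>, the jump by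
      \<open>- e\<close> back to \<open>x\<close> already contributes
      \<open>\<kappa> (u x) > 0\<close>.\<close>
    have "W * Re (?u (x + e)) = Re (?K ?u (x + e)) + Re (l2_delta 0 (x + e))"
      using arg_cong[OF neumann_right[OF w l2_delta(1), of 0 "x + e"], of Re] by simp
    moreover have "\<kappa> * Re (?u ((x + e) + - e)) \<le> Re (?K ?u (x + e))"
      using assms \<gamma> step(2)
      by (intro Re_positive_part_ge(2) nonneg uminus_unit_steps_tuple) auto
    moreover have "0 < \<kappa> * Re (?u x)" using step assms by simp
    moreover have "0 \<le> Re (l2_delta 0 (x + e))" by (simp add: l2_delta_def)
    ultimately have "0 < W * Re (?u (x + e))" by simp
    then show ?case using Wr by (simp add: zero_less_mult_iff)
  qed (rule u0)
  have u_nonzero: "?u \<noteq> (\<lambda>x. 0)" using u0 by auto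
  have u_eig: "?u \<in> l2_eigenspace T (of_real (W - c))"
    unfolding E by (auto intro: exI[of _ 1])
  have point: "of_real (W - c) \<in> l2_point_spectrum T"
    unfolding l2_point_spectrum_def using u_eig u_nonzero by blast
  then have spec: "complex_of_real (W - c) \<in> l2_spectrum T"
    using l2_point_spectrum_subset[OF bounded_T] by blast
  \<comment> \<open>\<open>W - c\<close> is an eigenvalue, hence in the spectrum, and bounds all
    real parts there, so the supremum is attained.\<close>
  have lam: "lam = W - c"
    unfolding assms(5) H
  proof (rule cSup_eq_maximum)
    show "W - c \<in> Re ` l2_spectrum T" using spec by (intro image_eqI) simp_all
  qed (use top in auto)
  \<comment> \<open>From \<open>W \<ge> \<gamma> + q\<close> follows
    \<open>lam \<ge> \<gamma> - c + q\<close>, which is positive.\<close>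
  have "0 < lam" using lam W \<gamma> q0 by simp
  moreover have "complex_of_real lam isolated_in l2_spectrum H"
    unfolding isolated_in_islimpt_iff islimpt_iff_eventually lam H
    using spec isolated by simp
  moreover have "one_dimensional (l2_eigenspace H (complex_of_real lam))"
    unfolding one_dimensional_def lam H E using u_nonzero by blast
  moreover have "(\<lambda>x. complex_of_real (Re (?u x))) \<in> l2_eigenspace H (complex_of_real lam)"
    using u_eig real unfolding lam H by presburger
  ultimately show ?thesis
    using point pos_u by (auto simp: lam H)
qed

end
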